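(* Let $\mathcal{M}$ be a preadditive braided monoidal category with equalizers. Assume that the tensor functors are additive and preserve equalizers. Assume further that $\mathcal{M}$ has denumerable coproducts and that the tensor functors preserve such coproducts. Let $\overline{\eta}_{\mathrm{Br}}$ and $\overline{\epsilon}_{\mathrm{Br}}$ be the unit and counit of the adjunction $(\overline{T}_{\mathrm{Br}},P_{\mathrm{Br}})$ between $\mathrm{Br}_{\mathcal M}$ and $\mathrm{BrBialg}_{\mathcal M}$, and consider the functors $\overline{T}:\mathcal{M}\to\mathrm{Bialg}_{\mathcal{M}}$ and $P:\mathrm{Bialg}_{\mathcal{M}}\to\mathcal{M}$. 1) There are unique natural transformations $\overline{\eta}:\mathrm{Id}_{\mathcal{M}}\to P\overline{T}$ and $\overline{\epsilon}:\overline{T}P\to\mathrm{Id}_{\mathrm{Bialg}_{\mathcal{M}}}$ such that $$\overline{\eta}_{\mathrm{Br}}J=J\overline{\eta},\qquad \overline{\epsilon}_{\mathrm{Br}}J_{\mathrm{Bialg}}=J_{\mathrm{Bialg}}\overline{\epsilon}.$$ 2) The pair $(\overline{T},P)$ is an adjunction with unit $\overline{\eta}$ and counit $\overline{\epsilon}$. 3) The unit $\overline{\eta}$ and the counit $\overline{\epsilon}$ are uniquely determined by the equalities $$\xi\overline{T}\circ\overline{\eta}=\eta,\qquad \epsilon\mho\circ T\xi=\mho\overline{\epsilon},$$ where $\eta$ and $\epsilon$ denote the unit and counit of the adjunction $(T,\Omega)$ respectively.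
   Context: Associativity constraints of $\mathcal M$ are suppressed; $l_X:\mathbf 1\otimes X\to X$, $r_X:X\otimes\mathbf 1\to X$; an object also denotes its identity morphism. The tensor functors are $M\otimes(-)$ and $(-)\otimes M$ for all objects $M$. $c_{U,V}:U\otimes V\to V\otimes U$ is the braiding of $\mathcal M$. $V^{\otimes 0}=\mathbf 1$, $V^{\otimes 1}=V$, $V^{\otimes n}=V^{\otimes(n-1)}\otimes V$ for $n\ge 2$. $\Delta_{\mathbf 1}=l_{\mathbf 1}^{-1}=r_{\mathbf 1}^{-1}$, $m_{\mathbf 1}=l_{\mathbf 1}=r_{\mathbf 1}$. Braided structures. A braided object is a pair $(V,c)$ with $c:V\otimes V\to V\otimes V$ invertible and $(c\otimes V)(V\otimes c)(c\otimes V)=(V\otimes c)(c\otimes V)(V\otimes c)$; a morphism $(V,c_V)\to(W,c_W)$ is $f:V\to W$ with $c_W(f\otimes f)=(f\otimes f)c_V$; category $\mathrm{Br}_{\mathcal M}$, forgetful functor $H:\mathrm{Br}_{\mathcal M}\to\mathcal M$. A braided algebra is $(A,m,u,c)$ with $(A,m,u)$ an algebra in $\mathcal M$, $(A,c)$ a braided object, and $c(m\otimes A)=(A\otimes m)(c\otimes A)(A\otimes c)$, $c(A\otimes m)=(m\otimes A)(A\otimes c)(c\otimes A)$, $c(u\otimes A)l_A^{-1}=(A\otimes u)r_A^{-1}$, $c(A\otimes u)r_A^{-1}=(u\otimes A)l_A^{-1}$; morphisms are algebra morphisms that are morphisms of braided objects; category $\mathrm{BrAlg}_{\mathcal M}$.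 A braided coalgebra is $(C,\Delta,\varepsilon,c)$ with $(C,\Delta,\varepsilon)$ a coalgebra, $(C,c)$ a braided object, and $(\Delta\otimes C)c=(C\otimes c)(c\otimes C)(C\otimes\Delta)$, $(C\otimes\Delta)c=(c\otimes C)(C\otimes c)(\Delta\otimes C)$, $l_C(\varepsilon\otimes C)c=r_C(C\otimes\varepsilon)$, $r_C(C\otimes\varepsilon)c=l_C(\varepsilon\otimes C)$. A braided bialgebra is $(B,m,u,\Delta,\varepsilon,c)$ with $(B,m,u,c)$ a braided algebra, $(B,\Delta,\varepsilon,c)$ a braided coalgebra, and $\Delta m=(m\otimes m)(B\otimes c\otimes B)(\Delta\otimes\Delta)$, $\Delta u=(u\otimes u)\Delta_{\mathbf 1}$, $\varepsilon m=m_{\mathbf 1}(\varepsilon\otimes\varepsilon)$, $\varepsilon u=\mathrm{Id}_{\mathbf 1}$; morphisms are algebra and coalgebra morphisms that are morphisms of braided objects; category $\mathrm{BrBialg}_{\mathcal M}$. $\Omega_{\mathrm{Br}}:\mathrm{BrAlg}_{\mathcal M}\to\mathrm{Br}_{\mathcal M}$ and $\mho_{\mathrm{Br}}:\mathrm{BrBialg}_{\mathcal M}\to\mathrm{BrAlg}_{\mathcal M}$ are the forgetful functors. Bialgebras. $\mathrm{Bialg}_{\mathcal M}$ is the category of quintuples $(B,m,u,\Delta,\varepsilon)$ with $(B,m,u)$ an algebra and $(B,\Delta,\varepsilon)$ a coalgebra in $\mathcal M$ such that $\Delta,\varepsilon$ are algebra morphisms, $B\otimes B$ being an algebra via $(m\otimes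 m)(B\otimes c_{B,B}\otimes B)$ and $(u\otimes u)l_{\mathbf 1}^{-1}$; morphisms are algebra and coalgebra morphisms. $\mho:\mathrm{Bialg}_{\mathcal M}\to\mathrm{Alg}_{\mathcal M}$ and $\Omega:\mathrm{Alg}_{\mathcal M}\to\mathcal M$ are the forgetful functors. $J:\mathcal M\to\mathrm{Br}_{\mathcal M}$, $JV=(V,c_{V,V})$, and $J_{\mathrm{Bialg}}:\mathrm{Bialg}_{\mathcal M}\to\mathrm{BrBialg}_{\mathcal M}$, $(B,m_B,u_B,\Delta_B,\varepsilon_B)\mapsto(B,m_B,u_B,\Delta_B,\varepsilon_B,c_{B,B})$, act as the identity on morphisms; both are full and faithful. Tensor algebras. $\Omega$ has a left adjoint $T$ with $\Omega TV=\oplus_{n\in\mathbb N}V^{\otimes n}$, injections $\alpha_nV:V^{\otimes n}\to\Omega TV$; $\Omega Tf\circ\alpha_nV=\alpha_nW\circ f^{\otimes n}$; $m_{\Omega TV}\circ(\alpha_mV\otimes\alpha_nV)=\alpha_{m+n}V$, $u_{\Omega TV}=\alpha_0V$; unit $\eta V=\alpha_1V$; counit given by $\Omega\epsilon(A,m_A,u_A)\circ\alpha_nA=m_A^{n-1}$ (iterated multiplication; $m_A^{-1}=u_A$, $m_A^0=\mathrm{Id}_A$). $\Omega_{\mathrm{Br}}$ has a left adjoint $T_{\mathrm{Br}}$ with $T_{\mathrm{Br}}(V,c)=(TV,c_T)$, $T_{\mathrm{Br}}(f)=T(f)$, where $c_T\circ(\alpha_mV\otimes\alpha_nV)=(\alpha_nV\otimes\alpha_mV)\circ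 c_T^{m,n}$; its unit $\eta_{\mathrm{Br}}$ and counit $\epsilon_{\mathrm{Br}}$ have the same underlying morphisms as $\eta$ and $\epsilon$. Here $c_T^{a,b}:V^{\otimes a}\otimes V^{\otimes b}\to V^{\otimes b}\otimes V^{\otimes a}$ is the unique family such that for all $l,m,n\in\mathbb N$ (identifying $V^{\otimes l}\otimes V^{\otimes m}$ with $V^{\otimes(l+m)}$ via the constraints): $(V^{\otimes n}\otimes c_T^{l,m})(c_T^{l,n}\otimes V^{\otimes m})(V^{\otimes l}\otimes c_T^{m,n})=(c_T^{m,n}\otimes V^{\otimes l})(V^{\otimes m}\otimes c_T^{l,n})(c_T^{l,m}\otimes V^{\otimes n})$; $(c_T^{l,n}\otimes V^{\otimes m})(V^{\otimes l}\otimes c_T^{m,n})=c_T^{l+m,n}$ for $l,m\ne0$; $(V^{\otimes m}\otimes c_T^{l,n})(c_T^{l,m}\otimes V^{\otimes n})=c_T^{l,m+n}$ for $m,n\ne0$; $c_T^{0,n}l_{V^{\otimes n}}^{-1}=r_{V^{\otimes n}}^{-1}$; $c_T^{n,0}r_{V^{\otimes n}}^{-1}=l_{V^{\otimes n}}^{-1}$; $c_T^{1,1}=c$. Writing $T_{\mathrm{Br}}(V,c)=(A,m_A,u_A,c_A)$, $\overline T_{\mathrm{Br}}(V,c)=(A,m_A,u_A,\Delta_A,\varepsilon_A,c_A)\in\mathrm{BrBialg}_{\mathcal M}$, where $\Delta_A:A\to A\otimes A$, $\varepsilon_A:A\to\mathbf 1$ are the unique algebra morphisms ($A\otimes A$ an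 algebra via $(m_A\otimes m_A)(A\otimes c_A\otimes A)$, $(u_A\otimes u_A)\Delta_{\mathbf 1}$) with $\Delta_A\circ\alpha_1V=(u_A\otimes\alpha_1V)l_V^{-1}+(\alpha_1V\otimes u_A)r_V^{-1}$ and $\varepsilon_A\circ\alpha_1V=0$; $\overline T_{\mathrm{Br}}(f)=T_{\mathrm{Br}}(f)$. When $(V,c)=JV$ one has $c_A=c_{A,A}$, so $\overline T(V):=(A,m_A,u_A,\Delta_A,\varepsilon_A)\in\mathrm{Bialg}_{\mathcal M}$; this defines $\overline T:\mathcal M\to\mathrm{Bialg}_{\mathcal M}$ with $\overline T(f)$ the unique morphism such that $J_{\mathrm{Bialg}}\overline T(f)=\overline T_{\mathrm{Br}}J(f)$. Thus $J_{\mathrm{Bialg}}\overline T=\overline T_{\mathrm{Br}}J$ and $\mho\overline T=T$. Primitives. For $\mathbb A=(A,m_A,u_A,\Delta_A,\varepsilon_A,c_A)\in\mathrm{BrBialg}_{\mathcal M}$, $\xi\mathbb A:P(\mathbb A)\to A$ is a chosen equalizer of $\Delta_A$ and $(A\otimes u_A)r_A^{-1}+(u_A\otimes A)l_A^{-1}$, and $P_{\mathrm{Br}}(\mathbb A)=(P(\mathbb A),c_{P(\mathbb A)})$ with $c_{P(\mathbb A)}$ the unique morphism such that $(\xi\mathbb A\otimes\xi\mathbb A)c_{P(\mathbb A)}=c_A(\xi\mathbb A\otimes\xi\mathbb A)$; $P_{\mathrm{Br}}(f)$ is the unique morphism with $\xi\mathbb A'\circ P_{\mathrm{Br}}(f)=f\circ\xi\mathbb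 A$. Then $\xi:P_{\mathrm{Br}}\to\Omega_{\mathrm{Br}}\mho_{\mathrm{Br}}$ is natural. $P:=H\circ P_{\mathrm{Br}}\circ J_{\mathrm{Bialg}}:\mathrm{Bialg}_{\mathcal M}\to\mathcal M$; for $\mathbb B\in\mathrm{Bialg}_{\mathcal M}$ the canonical equalizer morphism $P(\mathbb B)\to B$ is again denoted $\xi\mathbb B$, so $\xi:P\to\Omega\mho$; one has $P_{\mathrm{Br}}J_{\mathrm{Bialg}}=JP$ and $\xi J_{\mathrm{Bialg}}=J\xi$. $\overline T_{\mathrm{Br}}$ is left adjoint to $P_{\mathrm{Br}}$, and the unit $\overline\eta_{\mathrm{Br}}$ and counit $\overline\epsilon_{\mathrm{Br}}$ are the natural transformations uniquely determined by $\xi\overline T_{\mathrm{Br}}\circ\overline\eta_{\mathrm{Br}}=\eta_{\mathrm{Br}}$ and $\epsilon_{\mathrm{Br}}\mho_{\mathrm{Br}}\circ T_{\mathrm{Br}}\xi=\mho_{\mathrm{Br}}\overline\epsilon_{\mathrm{Br}}$. *)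

theory Defs
  imports "HOL-Algebra.Group" "HOL-Library.FuncSet"
begin

no_notation monoid.mult (infixl "\<otimes>\<index>" 70)
no_notation monoid.one ("\<one>\<index>")

section \<open>Categories, functors, natural transformations\<close>

text \<open>Hom-sets are indexed by source and target and need not be disjoint (categories with disjoint
  hom-sets are a special case). In this way a morphism of structured objects is literally
  its underlying morphism; in exchange, functors take the source and the target of a morphism
  as additional arguments.\<close>

record ('o, 'm) cat =
  Obj :: "'o set"
  Hom :: "'o \<Rightarrow> 'o \<Rightarrow> 'm set"
  cmp :: "'m \<Rightarrow> 'm \<Rightarrow> 'm"  (infixr "\<cdot>\<index>" 65)
  ident :: "'o \<Rightarrow> 'm"  ("ID\<index>")

locale category =
  fixes C :: "('o, 'm, 'z) cat_scheme" (structure)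
  assumes Hom_Obj: "f \<in> Hom C X Y \<Longrightarrow> X \<in> Obj C \<and> Y \<in> Obj C"
    and ident_Hom: "X \<in> Obj C \<Longrightarrow> ID X \<in> Hom C X X"
    and cmp_Hom: "f \<in> Hom C X Y \<Longrightarrow> g \<in> Hom C Y Z \<Longrightarrow> g \<cdot> f \<in> Hom C X Z"
    and ident_left: "f \<in> Hom C X Y \<Longrightarrow> ID Y \<cdot> f = f"
    and ident_right: "f \<in> Hom C X Y \<Longrightarrow> f \<cdot> ID X = f"
    and cmp_assoc: "f \<in> Hom C W X \<Longrightarrow> g \<in> Hom C X Y \<Longrightarrow> h \<in> Hom C Y Z
      \<Longrightarrow> (h \<cdot> g) \<cdot> f = h \<cdot> g \<cdot> f"

definition inverse_arrows where
  "inverse_arrows C X Y f g \<longleftrightarrow> f \<in> Hom C X Y \<and> g \<in> Hom C Y X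
     \<and> g \<cdot>\<^bsub>C\<^esub> f = ID\<^bsub>C\<^esub> X \<and> f \<cdot>\<^bsub>C\<^esub> g = ID\<^bsub>C\<^esub> Y"

definition iso_arrow where
  "iso_arrow C X Y f \<longleftrightarrow> (\<exists>g. inverse_arrows C X Y f g)"

definition inv_arrow where
  "inv_arrow C X Y f = (THE g. inverse_arrows C X Y f g)"

definition is_equalizer where
  "is_equalizer C X Y f g E e \<longleftrightarrow>
     f \<in> Hom C X Y \<and> g \<in> Hom C X Y \<and> e \<in> Hom C E X \<and> f \<cdot>\<^bsub>C\<^esub> e = g \<cdot>\<^bsub>C\<^esub> e \<and>
     (\<forall>Z h. h \<in> Hom C Z X \<and> f \<cdot>\<^bsub>C\<^esub> h = g \<cdot>\<^bsub>C\<^esub> h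
        \<longrightarrow> (\<exists>!k. k \<in> Hom C Z E \<and> e \<cdot>\<^bsub>C\<^esub> k = h))"

definition has_equalizers where
  "has_equalizers C \<longleftrightarrow>
     (\<forall>X Y f g. f \<in> Hom C X Y \<and> g \<in> Hom C X Y \<longrightarrow> (\<exists>E e. is_equalizer C X Y f g E e))"

definition is_coproduct where
  "is_coproduct C (X :: nat \<Rightarrow> 'o) Q i \<longleftrightarrow>
     Q \<in> Obj C \<and> (\<forall>n. i n \<in> Hom C (X n) Q) \<and>
     (\<forall>Z\<in>Obj C. \<forall>f. (\<forall>n. f n \<in> Hom C (X n) Z)
        \<longrightarrow> (\<exists>!h. h \<in> Hom C Q Z \<and> (\<forall>n. h \<cdot>\<^bsub>C\<^esub> i n = f n)))"

definition has_denumerable_coproducts where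
  "has_denumerable_coproducts C \<longleftrightarrow>
     (\<forall>X :: nat \<Rightarrow> 'o. range X \<subseteq> Obj C \<longrightarrow> (\<exists>Q i. is_coproduct C X Q i))"

record ('o, 'm, 'p, 'n) func =
  fob :: "'o \<Rightarrow> 'p"
  fmor :: "'o \<Rightarrow> 'o \<Rightarrow> 'm \<Rightarrow> 'n"

definition is_functor ::
  "('o, 'm, 'y) cat_scheme \<Rightarrow> ('p, 'n, 'z) cat_scheme \<Rightarrow> ('o, 'm, 'p, 'n) func \<Rightarrow> bool" where
  "is_functor C D F \<longleftrightarrow> category C \<and> category D \<and>
     (\<forall>X\<in>Obj C. fob F X \<in> Obj D) \<and>
     (\<forall>X Y. \<forall>f\<in>Hom C X Y. fmor F X Y f \<in> Hom D (fob F X) (fob F Y)) \<and>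
     (\<forall>X\<in>Obj C. fmor F X X (ID\<^bsub>C\<^esub> X) = ID\<^bsub>D\<^esub> (fob F X)) \<and>
     (\<forall>X Y Z. \<forall>f\<in>Hom C X Y. \<forall>g\<in>Hom C Y Z.
        fmor F X Z (g \<cdot>\<^bsub>C\<^esub> f) = fmor F Y Z g \<cdot>\<^bsub>D\<^esub> fmor F X Y f)"

definition Id_func :: "('o, 'm, 'o, 'm) func" where
  "Id_func = \<lparr>fob = (\<lambda>X. X), fmor = (\<lambda>X Y f. f)\<rparr>"

definition comp_func ::
  "('p, 'n, 'q, 'k) func \<Rightarrow> ('o, 'm, 'p, 'n) func \<Rightarrow> ('o, 'm, 'q, 'k) func"
  (infixr "\<circ>\<^sub>F" 60) where
  "G \<circ>\<^sub>F F = \<lparr>fob = (\<lambda>X. fob G (fob F X)),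
             fmor = (\<lambda>X Y f. fmor G (fob F X) (fob F Y) (fmor F X Y f))\<rparr>"

text \<open>Natural transformations are extensional families (value \<^const>\<open>undefined\<close> outside of the
  objects), so that equality of functions is equality of natural transformations.\<close>

definition nat_transformation ::
  "('o, 'm, 'y) cat_scheme \<Rightarrow> ('p, 'n, 'z) cat_scheme \<Rightarrow> ('o, 'm, 'p, 'n) func
    \<Rightarrow> ('o, 'm, 'p, 'n) func \<Rightarrow> ('o \<Rightarrow> 'n) \<Rightarrow> bool" where
  "nat_transformation C D F G \<eta> \<longleftrightarrow> is_functor C D F \<and> is_functor C D G \<and>
     \<eta> \<in> (\<Pi>\<^sub>E X\<in>Obj C. Hom D (fob F X) (fob G X)) \<and>
     (\<forall>X Y. \<forall>f\<in>Hom C X Y. fmor G X Y f \<cdot>\<^bsub>D\<^esub> \<eta> X = \<eta> Y \<cdot>\<^bsub>D\<^esub> fmor F X Y f)"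

text \<open>For categories \<open>C\<close>, \<open>D\<close> and natural transformations \<open>\<alpha> : F \<rightarrow> G\<close>, \<open>\<beta> : G \<rightarrow> H\<close>
  of functors from \<open>C\<close> to \<open>D\<close>: the vertical composite \<open>\<beta> \<circ> \<alpha>\<close>, the whiskering \<open>\<eta> K\<close> by a
  functor \<open>K\<close> with source \<open>C\<close>, and the whiskering \<open>K \<alpha>\<close> by a functor \<open>K\<close> with source \<open>D\<close>.\<close>

definition vcomp ::
  "('o, 'm, 'y) cat_scheme \<Rightarrow> ('p, 'n, 'z) cat_scheme \<Rightarrow> ('o \<Rightarrow> 'n) \<Rightarrow> ('o \<Rightarrow> 'n) \<Rightarrow> 'o \<Rightarrow> 'n" where
  "vcomp C D \<beta> \<alpha> = (\<lambda>X\<in>Obj C. \<beta> X \<cdot>\<^bsub>D\<^esub> \<alpha> X)"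

definition pre_whisker ::
  "('o, 'm, 'y) cat_scheme \<Rightarrow> ('p \<Rightarrow> 'n) \<Rightarrow> ('o, 'm, 'p, 'k) func \<Rightarrow> 'o \<Rightarrow> 'n" where
  "pre_whisker C \<eta> K = (\<lambda>X\<in>Obj C. \<eta> (fob K X))"

definition post_whisker ::
  "('o, 'm, 'y) cat_scheme \<Rightarrow> ('p, 'n, 'q, 'k) func \<Rightarrow> ('o, 'm, 'p, 'n) func
    \<Rightarrow> ('o, 'm, 'p, 'n) func \<Rightarrow> ('o \<Rightarrow> 'n) \<Rightarrow> 'o \<Rightarrow> 'k" where
  "post_whisker C K F G \<alpha> = (\<lambda>X\<in>Obj C. fmor K (fob F X) (fob G X) (\<alpha> X))"

definition adjunction ::
  "('o, 'm, 'y) cat_scheme \<Rightarrow> ('p, 'n, 'z) cat_scheme \<Rightarrow> ('o, 'm, 'p, 'n) func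
    \<Rightarrow> ('p, 'n, 'o, 'm) func \<Rightarrow> ('o \<Rightarrow> 'm) \<Rightarrow> ('p \<Rightarrow> 'n) \<Rightarrow> bool" where
  "adjunction C D F G \<eta> \<epsilon> \<longleftrightarrow>
     is_functor C D F \<and> is_functor D C G \<and>
     nat_transformation C C Id_func (G \<circ>\<^sub>F F) \<eta> \<and>
     nat_transformation D D (F \<circ>\<^sub>F G) Id_func \<epsilon> \<and>
     vcomp C D (pre_whisker C \<epsilon> F) (post_whisker C F Id_func (G \<circ>\<^sub>F F) \<eta>)
       = (\<lambda>X\<in>Obj C. ID\<^bsub>D\<^esub> (fob F X)) \<and>
     vcomp D C (post_whisker D G (F \<circ>\<^sub>F G) Id_func \<epsilon>) (pre_whisker D \<eta> G)
       = (\<lambda>Y\<in>Obj D. ID\<^bsub>C\<^esub> (fob G Y))"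


section \<open>Preadditive braided monoidal categories\<close>

record ('o, 'm) pbm_cat = "('o, 'm) cat" +
  unit_obj :: 'o  ("\<one>\<index>")
  tensor_obj :: "'o \<Rightarrow> 'o \<Rightarrow> 'o"  (infixl "\<otimes>\<index>" 75)
  tensor :: "'m \<Rightarrow> 'm \<Rightarrow> 'm"  (infixl "\<otimes>\<^sub>m\<index>" 75)
  assoc :: "'o \<Rightarrow> 'o \<Rightarrow> 'o \<Rightarrow> 'm"  ("\<a>\<index>")
  lunit :: "'o \<Rightarrow> 'm"  ("\<l>\<index>")
  runit :: "'o \<Rightarrow> 'm"  ("\<r>\<index>")
  braiding :: "'o \<Rightarrow> 'o \<Rightarrow> 'm"  ("\<c>\<index>")
  hom_add :: "'m \<Rightarrow> 'm \<Rightarrow> 'm"  (infixl "\<oplus>\<index>" 60)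
  hom_zero :: "'o \<Rightarrow> 'o \<Rightarrow> 'm"

definition assoc_inv :: "('o, 'm) pbm_cat \<Rightarrow> 'o \<Rightarrow> 'o \<Rightarrow> 'o \<Rightarrow> 'm"  ("\<a>\<^sup>-\<index>") where
  "\<a>\<^sup>-\<^bsub>M\<^esub> X Y Z = inv_arrow M ((X \<otimes>\<^bsub>M\<^esub> Y) \<otimes>\<^bsub>M\<^esub> Z) (X \<otimes>\<^bsub>M\<^esub> (Y \<otimes>\<^bsub>M\<^esub> Z)) (\<a>\<^bsub>M\<^esub> X Y Z)"

definition lunit_inv :: "('o, 'm) pbm_cat \<Rightarrow> 'o \<Rightarrow> 'm"  ("\<l>\<^sup>-\<index>") where
  "\<l>\<^sup>-\<^bsub>M\<^esub> X = inv_arrow M (\<one>\<^bsub>M\<^esub> \<otimes>\<^bsub>M\<^esub> X) X (\<l>\<^bsub>M\<^esub> X)"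

definition runit_inv :: "('o, 'm) pbm_cat \<Rightarrow> 'o \<Rightarrow> 'm"  ("\<r>\<^sup>-\<index>") where
  "\<r>\<^sup>-\<^bsub>M\<^esub> X = inv_arrow M (X \<otimes>\<^bsub>M\<^esub> \<one>\<^bsub>M\<^esub>) X (\<r>\<^bsub>M\<^esub> X)"

locale monoidal_category = category M
  for M :: "('o, 'm) pbm_cat" (structure) +
  assumes unit_Obj: "\<one> \<in> Obj M"
    and tensor_Obj: "X \<in> Obj M \<Longrightarrow> Y \<in> Obj M \<Longrightarrow> X \<otimes> Y \<in> Obj M"
    and tensor_Hom: "f \<in> Hom M X Y \<Longrightarrow> f' \<in> Hom M X' Y' \<Longrightarrow> f \<otimes>\<^sub>m f' \<in> Hom M (X \<otimes> X') (Y \<otimes> Y')"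
    and tensor_ident: "X \<in> Obj M \<Longrightarrow> Y \<in> Obj M \<Longrightarrow> ID X \<otimes>\<^sub>m ID Y = ID (X \<otimes> Y)"
    and tensor_cmp: "f \<in> Hom M X Y \<Longrightarrow> g \<in> Hom M Y Z \<Longrightarrow> f' \<in> Hom M X' Y' \<Longrightarrow> g' \<in> Hom M Y' Z'
      \<Longrightarrow> (g \<cdot> f) \<otimes>\<^sub>m (g' \<cdot> f') = (g \<otimes>\<^sub>m g') \<cdot> (f \<otimes>\<^sub>m f')"
    and assoc_iso: "X \<in> Obj M \<Longrightarrow> Y \<in> Obj M \<Longrightarrow> Z \<in> Obj M
      \<Longrightarrow> iso_arrow M ((X \<otimes> Y) \<otimes> Z) (X \<otimes> (Y \<otimes> Z)) (\<a> X Y Z)"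
    and assoc_natural: "f \<in> Hom M X X' \<Longrightarrow> g \<in> Hom M Y Y' \<Longrightarrow> h \<in> Hom M Z Z'
      \<Longrightarrow> \<a> X' Y' Z' \<cdot> ((f \<otimes>\<^sub>m g) \<otimes>\<^sub>m h) = (f \<otimes>\<^sub>m (g \<otimes>\<^sub>m h)) \<cdot> \<a> X Y Z"
    and lunit_iso: "X \<in> Obj M \<Longrightarrow> iso_arrow M (\<one> \<otimes> X) X (\<l> X)"
    and lunit_natural: "f \<in> Hom M X Y \<Longrightarrow> \<l> Y \<cdot> (ID \<one> \<otimes>\<^sub>m f) = f \<cdot> \<l> X"
    and runit_iso: "X \<in> Obj M \<Longrightarrow> iso_arrow M (X \<otimes> \<one>) X (\<r> X)"
    and runit_natural: "f \<in> Hom M X Y \<Longrightarrow> \<r> Y \<cdot> (f \<otimes>\<^sub>m ID \<one>) = f \<cdot> \<r> X"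
    and pentagon: "W \<in> Obj M \<Longrightarrow> X \<in> Obj M \<Longrightarrow> Y \<in> Obj M \<Longrightarrow> Z \<in> Obj M
      \<Longrightarrow> (ID W \<otimes>\<^sub>m \<a> X Y Z) \<cdot> \<a> W (X \<otimes> Y) Z \<cdot> (\<a> W X Y \<otimes>\<^sub>m ID Z)
        = \<a> W X (Y \<otimes> Z) \<cdot> \<a> (W \<otimes> X) Y Z"
    and triangle: "X \<in> Obj M \<Longrightarrow> Y \<in> Obj M
      \<Longrightarrow> (ID X \<otimes>\<^sub>m \<l> Y) \<cdot> \<a> X \<one> Y = \<r> X \<otimes>\<^sub>m ID Y"

locale braided_monoidal_category = monoidal_category +
  assumes braiding_iso: "X \<in> Obj M \<Longrightarrow> Y \<in> Obj M \<Longrightarrow> iso_arrow M (X \<otimes> Y) (Y \<otimes> X) (\<c> X Y)"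
    and braiding_natural: "f \<in> Hom M X X' \<Longrightarrow> g \<in> Hom M Y Y'
      \<Longrightarrow> \<c> X' Y' \<cdot> (f \<otimes>\<^sub>m g) = (g \<otimes>\<^sub>m f) \<cdot> \<c> X Y"
    and hexagon1: "X \<in> Obj M \<Longrightarrow> Y \<in> Obj M \<Longrightarrow> Z \<in> Obj M
      \<Longrightarrow> \<a> Y Z X \<cdot> \<c> X (Y \<otimes> Z) \<cdot> \<a> X Y Z
        = (ID Y \<otimes>\<^sub>m \<c> X Z) \<cdot> \<a> Y X Z \<cdot> (\<c> X Y \<otimes>\<^sub>m ID Z)"
    and hexagon2: "X \<in> Obj M \<Longrightarrow> Y \<in> Obj M \<Longrightarrow> Z \<in> Obj M
      \<Longrightarrow> \<a>\<^sup>- Z X Y \<cdot> \<c> (X \<otimes> Y) Z \<cdot> \<a>\<^sup>- X Y Z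
        = (\<c> X Z \<otimes>\<^sub>m ID Y) \<cdot> \<a>\<^sup>- X Z Y \<cdot> (ID X \<otimes>\<^sub>m \<c> Y Z)"

locale preadditive_braided_monoidal_category = braided_monoidal_category +
  assumes Hom_group: "X \<in> Obj M \<Longrightarrow> Y \<in> Obj M \<Longrightarrow>
      comm_group \<lparr>carrier = Hom M X Y, monoid.mult = hom_add M, monoid.one = hom_zero M X Y\<rparr>"
    and cmp_add_left: "f \<in> Hom M X Y \<Longrightarrow> g \<in> Hom M Y Z \<Longrightarrow> g' \<in> Hom M Y Z
      \<Longrightarrow> (g \<oplus> g') \<cdot> f = (g \<cdot> f) \<oplus> (g' \<cdot> f)"
    and cmp_add_right: "f \<in> Hom M X Y \<Longrightarrow> f' \<in> Hom M X Y \<Longrightarrow> g \<in> Hom M Y Z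
      \<Longrightarrow> g \<cdot> (f \<oplus> f') = (g \<cdot> f) \<oplus> (g \<cdot> f')"

context
  fixes M :: "('o, 'm) pbm_cat" (structure)
begin

definition tensor_additive where
  "tensor_additive \<longleftrightarrow> (\<forall>W\<in>Obj M. \<forall>X Y. \<forall>f\<in>Hom M X Y. \<forall>g\<in>Hom M X Y.
     ID W \<otimes>\<^sub>m (f \<oplus> g) = (ID W \<otimes>\<^sub>m f) \<oplus> (ID W \<otimes>\<^sub>m g) \<and>
     (f \<oplus> g) \<otimes>\<^sub>m ID W = (f \<otimes>\<^sub>m ID W) \<oplus> (g \<otimes>\<^sub>m ID W))"

definition tensor_preserves_equalizers where
  "tensor_preserves_equalizers \<longleftrightarrow>
     (\<forall>W\<in>Obj M. \<forall>X Y f g E e. is_equalizer M X Y f g E e \<longrightarrow>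
       is_equalizer M (W \<otimes> X) (W \<otimes> Y) (ID W \<otimes>\<^sub>m f) (ID W \<otimes>\<^sub>m g) (W \<otimes> E) (ID W \<otimes>\<^sub>m e) \<and>
       is_equalizer M (X \<otimes> W) (Y \<otimes> W) (f \<otimes>\<^sub>m ID W) (g \<otimes>\<^sub>m ID W) (E \<otimes> W) (e \<otimes>\<^sub>m ID W))"

definition tensor_preserves_denumerable_coproducts where
  "tensor_preserves_denumerable_coproducts \<longleftrightarrow>
     (\<forall>W\<in>Obj M. \<forall>X Q i. is_coproduct M X Q i \<longrightarrow>
       is_coproduct M (\<lambda>n. W \<otimes> X n) (W \<otimes> Q) (\<lambda>n. ID W \<otimes>\<^sub>m i n) \<and>
       is_coproduct M (\<lambda>n. X n \<otimes> W) (Q \<otimes> W) (\<lambda>n. i n \<otimes>\<^sub>m ID W))"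


section \<open>Algebras, coalgebras and their braided versions\<close>

text \<open>The associativity constraints, suppressed in the usual notation, are inserted explicitly.\<close>

definition is_algebra where
  "is_algebra A m u \<longleftrightarrow> A \<in> Obj M \<and> m \<in> Hom M (A \<otimes> A) A \<and> u \<in> Hom M \<one> A \<and>
     m \<cdot> (m \<otimes>\<^sub>m ID A) = m \<cdot> (ID A \<otimes>\<^sub>m m) \<cdot> \<a> A A A \<and>
     m \<cdot> (u \<otimes>\<^sub>m ID A) = \<l> A \<and> m \<cdot> (ID A \<otimes>\<^sub>m u) = \<r> A"

definition alg_morphism where
  "alg_morphism = (\<lambda>(A, m, u) (A', m', u') f.
     f \<in> Hom M A A' \<and> f \<cdot> m = m' \<cdot> (f \<otimes>\<^sub>m f) \<and> f \<cdot> u = u')"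

definition is_coalgebra where
  "is_coalgebra C \<Delta> \<epsilon> \<longleftrightarrow> C \<in> Obj M \<and> \<Delta> \<in> Hom M C (C \<otimes> C) \<and> \<epsilon> \<in> Hom M C \<one> \<and>
     \<a> C C C \<cdot> (\<Delta> \<otimes>\<^sub>m ID C) \<cdot> \<Delta> = (ID C \<otimes>\<^sub>m \<Delta>) \<cdot> \<Delta> \<and>
     \<l> C \<cdot> (\<epsilon> \<otimes>\<^sub>m ID C) \<cdot> \<Delta> = ID C \<and> \<r> C \<cdot> (ID C \<otimes>\<^sub>m \<epsilon>) \<cdot> \<Delta> = ID C"

definition coalg_morphism where
  "coalg_morphism = (\<lambda>(C, \<Delta>, \<epsilon>) (C', \<Delta>', \<epsilon>') f.
     f \<in> Hom M C C' \<and> \<Delta>' \<cdot> f = (f \<otimes>\<^sub>m f) \<cdot> \<Delta> \<and> \<epsilon>' \<cdot> f = \<epsilon>)"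

definition is_braided_object where
  "is_braided_object V c \<longleftrightarrow> V \<in> Obj M \<and> iso_arrow M (V \<otimes> V) (V \<otimes> V) c \<and>
     (let c1 = c \<otimes>\<^sub>m ID V; c2 = \<a>\<^sup>- V V V \<cdot> (ID V \<otimes>\<^sub>m c) \<cdot> \<a> V V V
      in c1 \<cdot> c2 \<cdot> c1 = c2 \<cdot> c1 \<cdot> c2)"

definition br_morphism where
  "br_morphism = (\<lambda>(V, c) (V', c') f. f \<in> Hom M V V' \<and> c' \<cdot> (f \<otimes>\<^sub>m f) = (f \<otimes>\<^sub>m f) \<cdot> c)"

definition is_braided_algebra where
  "is_braided_algebra A m u c \<longleftrightarrow> is_algebra A m u \<and> is_braided_object A c \<and>
     c \<cdot> (m \<otimes>\<^sub>m ID A)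
       = (ID A \<otimes>\<^sub>m m) \<cdot> \<a> A A A \<cdot> (c \<otimes>\<^sub>m ID A) \<cdot> \<a>\<^sup>- A A A \<cdot> (ID A \<otimes>\<^sub>m c) \<cdot> \<a> A A A \<and>
     c \<cdot> (ID A \<otimes>\<^sub>m m)
       = (m \<otimes>\<^sub>m ID A) \<cdot> \<a>\<^sup>- A A A \<cdot> (ID A \<otimes>\<^sub>m c) \<cdot> \<a> A A A \<cdot> (c \<otimes>\<^sub>m ID A) \<cdot> \<a>\<^sup>- A A A \<and>
     c \<cdot> (u \<otimes>\<^sub>m ID A) \<cdot> \<l>\<^sup>- A = (ID A \<otimes>\<^sub>m u) \<cdot> \<r>\<^sup>- A \<and>
     c \<cdot> (ID A \<otimes>\<^sub>m u) \<cdot> \<r>\<^sup>- A = (u \<otimes>\<^sub>m ID A) \<cdot> \<l>\<^sup>- A"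

definition is_braided_coalgebra where
  "is_braided_coalgebra C \<Delta> \<epsilon> c \<longleftrightarrow> is_coalgebra C \<Delta> \<epsilon> \<and> is_braided_object C c \<and>
     (\<Delta> \<otimes>\<^sub>m ID C) \<cdot> c
       = \<a>\<^sup>- C C C \<cdot> (ID C \<otimes>\<^sub>m c) \<cdot> \<a> C C C \<cdot> (c \<otimes>\<^sub>m ID C) \<cdot> \<a>\<^sup>- C C C \<cdot> (ID C \<otimes>\<^sub>m \<Delta>) \<and>
     (ID C \<otimes>\<^sub>m \<Delta>) \<cdot> c
       = \<a> C C C \<cdot> (c \<otimes>\<^sub>m ID C) \<cdot> \<a>\<^sup>- C C C \<cdot> (ID C \<otimes>\<^sub>m c) \<cdot> \<a> C C C \<cdot> (\<Delta> \<otimes>\<^sub>m ID C) \<and>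
     \<l> C \<cdot> (\<epsilon> \<otimes>\<^sub>m ID C) \<cdot> c = \<r> C \<cdot> (ID C \<otimes>\<^sub>m \<epsilon>) \<and>
     \<r> C \<cdot> (ID C \<otimes>\<^sub>m \<epsilon>) \<cdot> c = \<l> C \<cdot> (\<epsilon> \<otimes>\<^sub>m ID C)"

text \<open>\<open>mid_arrow A c\<close> is \<open>A \<otimes> c \<otimes> A\<close>, viewed as an endomorphism of \<open>(A \<otimes> A) \<otimes> (A \<otimes> A)\<close>.\<close>

definition mid_arrow where
  "mid_arrow A c = \<a>\<^sup>- A A (A \<otimes> A)
     \<cdot> (ID A \<otimes>\<^sub>m (\<a> A A A \<cdot> (c \<otimes>\<^sub>m ID A) \<cdot> \<a>\<^sup>- A A A)) \<cdot> \<a> A A (A \<otimes> A)"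

definition tensor_alg where
  "tensor_alg = (\<lambda>(A, m, u) c.
     (A \<otimes> A, (m \<otimes>\<^sub>m m) \<cdot> mid_arrow A c, (u \<otimes>\<^sub>m u) \<cdot> \<l>\<^sup>- \<one>))"

definition unit_alg where
  "unit_alg = (\<one>, \<l> \<one>, ID \<one>)"

definition is_bialgebra where
  "is_bialgebra B m u \<Delta> \<epsilon> \<longleftrightarrow> is_algebra B m u \<and> is_coalgebra B \<Delta> \<epsilon> \<and>
     alg_morphism (B, m, u) (tensor_alg (B, m, u) (\<c> B B)) \<Delta> \<and>
     alg_morphism (B, m, u) unit_alg \<epsilon>"

definition is_braided_bialgebra where
  "is_braided_bialgebra B m u \<Delta> \<epsilon> c \<longleftrightarrow>
     is_braided_algebra B m u c \<and> is_braided_coalgebra B \<Delta> \<epsilon> c \<and>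
     \<Delta> \<cdot> m = (m \<otimes>\<^sub>m m) \<cdot> mid_arrow B c \<cdot> (\<Delta> \<otimes>\<^sub>m \<Delta>) \<and>
     \<Delta> \<cdot> u = (u \<otimes>\<^sub>m u) \<cdot> \<l>\<^sup>- \<one> \<and>
     \<epsilon> \<cdot> m = \<l> \<one> \<cdot> (\<epsilon> \<otimes>\<^sub>m \<epsilon>) \<and>
     \<epsilon> \<cdot> u = ID \<one>"

definition Alg :: "('o \<times> 'm \<times> 'm, 'm) cat" where
  "Alg = \<lparr>Obj = {(A, m, u). is_algebra A m u},
     Hom = (\<lambda>(A, m, u) (A', m', u'). {f. is_algebra A m u \<and> is_algebra A' m' u' \<and>
       alg_morphism (A, m, u) (A', m', u') f}),
     cmp = cmp M, ident = (\<lambda>(A, m, u). ID A)\<rparr>"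

definition Bialg :: "('o \<times> 'm \<times> 'm \<times> 'm \<times> 'm, 'm) cat" where
  "Bialg = \<lparr>Obj = {(B, m, u, \<Delta>, \<epsilon>). is_bialgebra B m u \<Delta> \<epsilon>},
     Hom = (\<lambda>(B, m, u, \<Delta>, \<epsilon>) (B', m', u', \<Delta>', \<epsilon>').
       {f. is_bialgebra B m u \<Delta> \<epsilon> \<and> is_bialgebra B' m' u' \<Delta>' \<epsilon>' \<and>
         alg_morphism (B, m, u) (B', m', u') f \<and> coalg_morphism (B, \<Delta>, \<epsilon>) (B', \<Delta>', \<epsilon>') f}),
     cmp = cmp M, ident = (\<lambda>(B, m, u, \<Delta>, \<epsilon>). ID B)\<rparr>"

definition Br :: "('o \<times> 'm, 'm) cat" where
  "Br = \<lparr>Obj = {(V, c). is_braided_object V c},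
     Hom = (\<lambda>(V, c) (V', c'). {f. is_braided_object V c \<and> is_braided_object V' c' \<and>
       br_morphism (V, c) (V', c') f}),
     cmp = cmp M, ident = (\<lambda>(V, c). ID V)\<rparr>"

definition BrAlg :: "('o \<times> 'm \<times> 'm \<times> 'm, 'm) cat" where
  "BrAlg = \<lparr>Obj = {(A, m, u, c). is_braided_algebra A m u c},
     Hom = (\<lambda>(A, m, u, c) (A', m', u', c').
       {f. is_braided_algebra A m u c \<and> is_braided_algebra A' m' u' c' \<and>
         alg_morphism (A, m, u) (A', m', u') f \<and> br_morphism (A, c) (A', c') f}),
     cmp = cmp M, ident = (\<lambda>(A, m, u, c). ID A)\<rparr>"

definition BrBialg :: "('o \<times> 'm \<times> 'm \<times> 'm \<times> 'm \<times> 'm, 'm) cat" where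
  "BrBialg = \<lparr>Obj = {(B, m, u, \<Delta>, \<epsilon>, c). is_braided_bialgebra B m u \<Delta> \<epsilon> c},
     Hom = (\<lambda>(B, m, u, \<Delta>, \<epsilon>, c) (B', m', u', \<Delta>', \<epsilon>', c').
       {f. is_braided_bialgebra B m u \<Delta> \<epsilon> c \<and> is_braided_bialgebra B' m' u' \<Delta>' \<epsilon>' c' \<and>
         alg_morphism (B, m, u) (B', m', u') f \<and> coalg_morphism (B, \<Delta>, \<epsilon>) (B', \<Delta>', \<epsilon>') f \<and>
         br_morphism (B, c) (B', c') f}),
     cmp = cmp M, ident = (\<lambda>(B, m, u, \<Delta>, \<epsilon>, c). ID B)\<rparr>"

definition J :: "('o, 'm, 'o \<times> 'm, 'm) func" where
  "J = \<lparr>fob = (\<lambda>V. (V, \<c> V V)), fmor = (\<lambda>_ _ f. f)\<rparr>"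

definition J_Bialg ::
  "('o \<times> 'm \<times> 'm \<times> 'm \<times> 'm, 'm, 'o \<times> 'm \<times> 'm \<times> 'm \<times> 'm \<times> 'm, 'm) func" where
  "J_Bialg = \<lparr>fob = (\<lambda>(B, m, u, \<Delta>, \<epsilon>). (B, m, u, \<Delta>, \<epsilon>, \<c> B B)), fmor = (\<lambda>_ _ f. f)\<rparr>"

end

text \<open>The forgetful functors \<open>H\<close>, \<open>\<Omega>\<close>, \<open>\<Omega>\<^sub>B\<^sub>r\<close>, \<open>\<mho>\<close>, \<open>\<mho>\<^sub>B\<^sub>r\<close>.\<close>

definition H_Br :: "('o \<times> 'm, 'm, 'o, 'm) func" where
  "H_Br = \<lparr>fob = (\<lambda>(V, c). V), fmor = (\<lambda>_ _ f. f)\<rparr>"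

definition Omega :: "('o \<times> 'm \<times> 'm, 'm, 'o, 'm) func" where
  "Omega = \<lparr>fob = (\<lambda>(A, m, u). A), fmor = (\<lambda>_ _ f. f)\<rparr>"

definition Omega_Br :: "('o \<times> 'm \<times> 'm \<times> 'm, 'm, 'o \<times> 'm, 'm) func" where
  "Omega_Br = \<lparr>fob = (\<lambda>(A, m, u, c). (A, c)), fmor = (\<lambda>_ _ f. f)\<rparr>"

definition Mho :: "('o \<times> 'm \<times> 'm \<times> 'm \<times> 'm, 'm, 'o \<times> 'm \<times> 'm, 'm) func" where
  "Mho = \<lparr>fob = (\<lambda>(B, m, u, \<Delta>, \<epsilon>). (B, m, u)), fmor = (\<lambda>_ _ f. f)\<rparr>"

definition Mho_Br ::
  "('o \<times> 'm \<times> 'm \<times> 'm \<times> 'm \<times> 'm, 'm, 'o \<times> 'm \<times> 'm \<times> 'm, 'm) func" where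
  "Mho_Br = \<lparr>fob = (\<lambda>(B, m, u, \<Delta>, \<epsilon>, c). (B, m, u, c)), fmor = (\<lambda>_ _ f. f)\<rparr>"


section \<open>Tensor algebras\<close>

context
  fixes M :: "('o, 'm) pbm_cat" (structure)
begin

fun tpow :: "'o \<Rightarrow> nat \<Rightarrow> 'o" where
  "tpow V 0 = \<one>"
| "tpow V (Suc 0) = V"
| "tpow V (Suc (Suc n)) = tpow V (Suc n) \<otimes> V"

fun tpow_mor :: "'m \<Rightarrow> nat \<Rightarrow> 'm" where
  "tpow_mor f 0 = ID \<one>"
| "tpow_mor f (Suc 0) = f"
| "tpow_mor f (Suc (Suc n)) = tpow_mor f (Suc n) \<otimes>\<^sub>m f"

text \<open>The canonical isomorphism from \<open>tpow V m \<otimes> tpow V n\<close> to \<open>tpow V (m + n)\<close> built from the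
  constraints.\<close>

fun tpow_iso :: "'o \<Rightarrow> nat \<Rightarrow> nat \<Rightarrow> 'm" where
  "tpow_iso V m 0 = \<r> (tpow V m)"
| "tpow_iso V 0 (Suc n) = \<l> (tpow V (Suc n))"
| "tpow_iso V (Suc m) (Suc 0) = ID (tpow V (Suc (Suc m)))"
| "tpow_iso V (Suc m) (Suc (Suc n)) =
     (tpow_iso V (Suc m) (Suc n) \<otimes>\<^sub>m ID V) \<cdot> \<a>\<^sup>- (tpow V (Suc m)) (tpow V (Suc n)) V"

text \<open>\<open>iter_mult A m u n\<close> is the iterated multiplication \<open>m\<^sub>A\<^sup>n\<^sup>-\<^sup>1\<close> from the \<open>n\<close>-th tensor power.\<close>

fun iter_mult :: "'o \<Rightarrow> 'm \<Rightarrow> 'm \<Rightarrow> nat \<Rightarrow> 'm" where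
  "iter_mult A m u 0 = u"
| "iter_mult A m u (Suc 0) = ID A"
| "iter_mult A m u (Suc (Suc n)) = m \<cdot> (iter_mult A m u (Suc n) \<otimes>\<^sub>m ID A)"

definition is_cT_family :: "'o \<Rightarrow> 'm \<Rightarrow> (nat \<Rightarrow> nat \<Rightarrow> 'm) \<Rightarrow> bool" where
  "is_cT_family V c g \<longleftrightarrow> (let T = tpow V; i = tpow_iso V in
     (\<forall>a b. g a b \<in> Hom M (T a \<otimes> T b) (T b \<otimes> T a)) \<and>
     (\<forall>l m n.
        (ID (T n) \<otimes>\<^sub>m g l m) \<cdot> \<a> (T n) (T l) (T m) \<cdot> (g l n \<otimes>\<^sub>m ID (T m))
          \<cdot> \<a>\<^sup>- (T l) (T n) (T m) \<cdot> (ID (T l) \<otimes>\<^sub>m g m n) \<cdot> \<a> (T l) (T m) (T n)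
        = \<a> (T n) (T m) (T l) \<cdot> (g m n \<otimes>\<^sub>m ID (T l)) \<cdot> \<a>\<^sup>- (T m) (T n) (T l)
          \<cdot> (ID (T m) \<otimes>\<^sub>m g l n) \<cdot> \<a> (T m) (T l) (T n) \<cdot> (g l m \<otimes>\<^sub>m ID (T n))) \<and>
     (\<forall>l m n. l \<noteq> 0 \<and> m \<noteq> 0 \<longrightarrow>
        (ID (T n) \<otimes>\<^sub>m i l m) \<cdot> \<a> (T n) (T l) (T m) \<cdot> (g l n \<otimes>\<^sub>m ID (T m))
          \<cdot> \<a>\<^sup>- (T l) (T n) (T m) \<cdot> (ID (T l) \<otimes>\<^sub>m g m n) \<cdot> \<a> (T l) (T m) (T n)
        = g (l + m) n \<cdot> (i l m \<otimes>\<^sub>m ID (T n))) \<and>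
     (\<forall>l m n. m \<noteq> 0 \<and> n \<noteq> 0 \<longrightarrow>
        (i m n \<otimes>\<^sub>m ID (T l)) \<cdot> \<a>\<^sup>- (T m) (T n) (T l) \<cdot> (ID (T m) \<otimes>\<^sub>m g l n)
          \<cdot> \<a> (T m) (T l) (T n) \<cdot> (g l m \<otimes>\<^sub>m ID (T n)) \<cdot> \<a>\<^sup>- (T l) (T m) (T n)
        = g l (m + n) \<cdot> (ID (T l) \<otimes>\<^sub>m i m n)) \<and>
     (\<forall>n. g 0 n \<cdot> \<l>\<^sup>- (T n) = \<r>\<^sup>- (T n)) \<and>
     (\<forall>n. g n 0 \<cdot> \<r>\<^sup>- (T n) = \<l>\<^sup>- (T n)) \<and>
     g 1 1 = c)"

definition cT_family :: "'o \<Rightarrow> 'm \<Rightarrow> nat \<Rightarrow> nat \<Rightarrow> 'm" where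
  "cT_family V c = (THE g. is_cT_family V c g)"

definition is_tensor_coproduct_choice :: "('o \<Rightarrow> 'o \<times> (nat \<Rightarrow> 'm)) \<Rightarrow> bool" where
  "is_tensor_coproduct_choice S \<longleftrightarrow>
     (\<forall>V\<in>Obj M. is_coproduct M (tpow V) (fst (S V)) (snd (S V)))"

context
  fixes S :: "'o \<Rightarrow> 'o \<times> (nat \<Rightarrow> 'm)"
    \<comment> \<open>choice, for each \<open>V\<close>, of a coproduct of the tensor powers of \<open>V\<close> with its injections\<close>
begin

definition tsum :: "'o \<Rightarrow> 'o" where
  "tsum V = fst (S V)"

definition tinj :: "nat \<Rightarrow> 'o \<Rightarrow> 'm" where
  "tinj n V = snd (S V) n"

definition tmult :: "'o \<Rightarrow> 'm" where
  "tmult V = (THE h. h \<in> Hom M (tsum V \<otimes> tsum V) (tsum V) \<and>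
     (\<forall>m n. h \<cdot> (tinj m V \<otimes>\<^sub>m tinj n V) = tinj (m + n) V \<cdot> tpow_iso V m n))"

definition T_mor :: "'o \<Rightarrow> 'o \<Rightarrow> 'm \<Rightarrow> 'm" where
  "T_mor V W f = (THE h. h \<in> Hom M (tsum V) (tsum W) \<and>
     (\<forall>n. h \<cdot> tinj n V = tinj n W \<cdot> tpow_mor f n))"

definition T_func :: "('o, 'm, 'o \<times> 'm \<times> 'm, 'm) func" where
  "T_func = \<lparr>fob = (\<lambda>V. (tsum V, tmult V, tinj 0 V)), fmor = T_mor\<rparr>"

definition eta :: "'o \<Rightarrow> 'm" where
  "eta = (\<lambda>V\<in>Obj M. tinj 1 V)"

definition epsilon :: "'o \<times> 'm \<times> 'm \<Rightarrow> 'm" where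
  "epsilon = (\<lambda>(A, m, u)\<in>Obj (Alg M). THE h. h \<in> Hom M (tsum A) A \<and>
     (\<forall>n. h \<cdot> tinj n A = iter_mult A m u n))"

definition tbraid :: "'o \<Rightarrow> 'm \<Rightarrow> 'm" where
  "tbraid V c = (THE h. h \<in> Hom M (tsum V \<otimes> tsum V) (tsum V \<otimes> tsum V) \<and>
     (\<forall>m n. h \<cdot> (tinj m V \<otimes>\<^sub>m tinj n V) = (tinj n V \<otimes>\<^sub>m tinj m V) \<cdot> cT_family V c m n))"

definition T_Br :: "('o \<times> 'm, 'm, 'o \<times> 'm \<times> 'm \<times> 'm, 'm) func" where
  "T_Br = \<lparr>fob = (\<lambda>(V, c). (tsum V, tmult V, tinj 0 V, tbraid V c)),
     fmor = (\<lambda>(V, c) (W, d). T_mor V W)\<rparr>"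

definition eta_Br :: "'o \<times> 'm \<Rightarrow> 'm" where
  "eta_Br = (\<lambda>(V, c)\<in>Obj (Br M). eta V)"

definition epsilon_Br :: "'o \<times> 'm \<times> 'm \<times> 'm \<Rightarrow> 'm" where
  "epsilon_Br = (\<lambda>(A, m, u, c)\<in>Obj (BrAlg M). epsilon (A, m, u))"

definition tcomult :: "'o \<Rightarrow> 'm \<Rightarrow> 'm" where
  "tcomult V c = (let A = (tsum V, tmult V, tinj 0 V); u = tinj 0 V in
     THE \<Delta>. alg_morphism M A (tensor_alg M A (tbraid V c)) \<Delta> \<and>
       \<Delta> \<cdot> tinj 1 V = ((u \<otimes>\<^sub>m tinj 1 V) \<cdot> \<l>\<^sup>- V) \<oplus> ((tinj 1 V \<otimes>\<^sub>m u) \<cdot> \<r>\<^sup>- V))"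

definition tcounit :: "'o \<Rightarrow> 'm" where
  "tcounit V = (THE \<epsilon>. alg_morphism M (tsum V, tmult V, tinj 0 V) (unit_alg M) \<epsilon> \<and>
     \<epsilon> \<cdot> tinj 1 V = hom_zero M V \<one>)"

definition Tbar_Br :: "('o \<times> 'm, 'm, 'o \<times> 'm \<times> 'm \<times> 'm \<times> 'm \<times> 'm, 'm) func" where
  "Tbar_Br = \<lparr>fob = (\<lambda>(V, c).
       (tsum V, tmult V, tinj 0 V, tcomult V c, tcounit V, tbraid V c)),
     fmor = fmor T_Br\<rparr>"

definition Tbar_obj :: "'o \<Rightarrow> 'o \<times> 'm \<times> 'm \<times> 'm \<times> 'm" where
  "Tbar_obj V = (case fob Tbar_Br (fob (J M) V) of (A, m, u, \<Delta>, \<epsilon>, c) \<Rightarrow> (A, m, u, \<Delta>, \<epsilon>))"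

definition Tbar :: "('o, 'm, 'o \<times> 'm \<times> 'm \<times> 'm \<times> 'm, 'm) func" where
  "Tbar = \<lparr>fob = Tbar_obj,
     fmor = (\<lambda>V W f. THE h. h \<in> Hom (Bialg M) (Tbar_obj V) (Tbar_obj W) \<and>
       fmor (J_Bialg M) (Tbar_obj V) (Tbar_obj W) h
         = fmor Tbar_Br (fob (J M) V) (fob (J M) W) (fmor (J M) V W f))\<rparr>"

end


section \<open>Primitives\<close>

definition is_primitives_choice :: "('o \<times> 'm \<times> 'm \<times> 'm \<times> 'm \<times> 'm \<Rightarrow> 'o \<times> 'm) \<Rightarrow> bool" where
  "is_primitives_choice E \<longleftrightarrow> (\<forall>(A, m, u, \<Delta>, \<epsilon>, c)\<in>Obj (BrBialg M).
     is_equalizer M A (A \<otimes> A)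
       \<Delta> (((ID A \<otimes>\<^sub>m u) \<cdot> \<r>\<^sup>- A) \<oplus> ((u \<otimes>\<^sub>m ID A) \<cdot> \<l>\<^sup>- A))
       (fst (E (A, m, u, \<Delta>, \<epsilon>, c))) (snd (E (A, m, u, \<Delta>, \<epsilon>, c))))"

context
  fixes E :: "'o \<times> 'm \<times> 'm \<times> 'm \<times> 'm \<times> 'm \<Rightarrow> 'o \<times> 'm"
    \<comment> \<open>choice of the equalizers defining the primitives\<close>
begin

definition prim_obj :: "'o \<times> 'm \<times> 'm \<times> 'm \<times> 'm \<times> 'm \<Rightarrow> 'o" where
  "prim_obj \<A> = fst (E \<A>)"

definition xi :: "'o \<times> 'm \<times> 'm \<times> 'm \<times> 'm \<times> 'm \<Rightarrow> 'm" where
  "xi = (\<lambda>\<A>\<in>Obj (BrBialg M). snd (E \<A>))"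

definition prim_braid :: "'o \<times> 'm \<times> 'm \<times> 'm \<times> 'm \<times> 'm \<Rightarrow> 'm" where
  "prim_braid = (\<lambda>(A, m, u, \<Delta>, \<epsilon>, c). let \<A> = (A, m, u, \<Delta>, \<epsilon>, c) in
     THE h. h \<in> Hom M (prim_obj \<A> \<otimes> prim_obj \<A>) (prim_obj \<A> \<otimes> prim_obj \<A>) \<and>
       (xi \<A> \<otimes>\<^sub>m xi \<A>) \<cdot> h = c \<cdot> (xi \<A> \<otimes>\<^sub>m xi \<A>))"

definition P_Br :: "('o \<times> 'm \<times> 'm \<times> 'm \<times> 'm \<times> 'm, 'm, 'o \<times> 'm, 'm) func" where
  "P_Br = \<lparr>fob = (\<lambda>\<A>. (prim_obj \<A>, prim_braid \<A>)),
     fmor = (\<lambda>\<A> \<A>' f. THE h. h \<in> Hom M (prim_obj \<A>) (prim_obj \<A>') \<and> xi \<A>' \<cdot> h = f \<cdot> xi \<A>)\<rparr>"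

definition P_func :: "('o \<times> 'm \<times> 'm \<times> 'm \<times> 'm, 'm, 'o, 'm) func" where
  "P_func = H_Br \<circ>\<^sub>F P_Br \<circ>\<^sub>F J_Bialg M"

definition xi_Bialg :: "'o \<times> 'm \<times> 'm \<times> 'm \<times> 'm \<Rightarrow> 'm" where
  "xi_Bialg = pre_whisker (Bialg M) xi (J_Bialg M)"

end

end

end

theory Submission
  imports Defs
begin

text \<open>For a braided category, \<open>J\<close> and \<open>J_Bialg\<close> identify \<open>M\<close> and its bialgebras with full
  subcategories of the braided objects and braided bialgebras: the hexagons and naturality give the
  Yang-Baxter equation and all compatibilities of \<open>\<c> A A\<close> with the structure maps, and naturality
  makes every morphism braided. The functors \<open>Tbar_Br\<close> and \<open>P_Br\<close> respect these subcategories: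
  the braiding of the tensor algebra over \<open>(V, \<c> V V)\<close> and the braiding of the primitives of a
  bialgebra are uniquely determined, and the braiding of \<open>M\<close> satisfies their defining equations.
  Hence the braided adjunction restricts, unit and counit included, and the characterizations of
  these by \<open>\<xi>\<close> and by the counit of the tensor algebra restrict with it.\<close>

section \<open>Full embeddings\<close>

text \<open>The braided adjunction and the two identities for its unit and counit are hypotheses, so
  category axioms, functoriality and the triangle identities are all inherited through equality of
  hom-sets. What remains is that \<open>Tbar\<close> and \<open>P_func\<close> agree strictly with
  \<open>Tbar_Br\<close> and \<open>P_Br\<close>, and on objects only the braiding component is in
  doubt. As \<open>cT_family\<close>, \<open>tbraid\<close> and \<open>prim_braid\<close> are
  definite descriptions, each needs a solution and its uniqueness. The solutions come from
  naturality and the hexagons; uniqueness comes, respectively, from induction on the tensor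
  exponents, from testing against coproduct injections in both tensor factors, and from
  \<open>\<xi> \<otimes>\<^sub>m \<xi>\<close> being a monomorphism. The obstacle is coherence: the
  constraints are explicit, and the axioms relate neither \<open>\<l>\<close> and
  \<open>\<r>\<close> to tensor products of two objects nor the braiding to the unit object, so
  these laws are derived from pentagon, triangle and hexagons. The two uniqueness claims of part 3
  differ in nature: the unit is pinned down because \<open>\<xi>\<close> is a monomorphism, the
  counit because \<open>Mho\<close> does not change morphisms.\<close>

lemma (in category) iso_arrow_inverse:
  assumes "iso_arrow C X Y f"
  shows "inverse_arrows C X Y f (inv_arrow C X Y f)"
proof -
  obtain g where g: "inverse_arrows C X Y f g"
    using assms unfolding iso_arrow_def by blast
  have "h = g" if h: "inverse_arrows C X Y f h" for h
  proof -
    have "h = (g \<cdot> f) \<cdot> h"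
      using g h ident_left unfolding inverse_arrows_def by metis
    also have "\<dots> = g \<cdot> f \<cdot> h"
      using g h cmp_assoc unfolding inverse_arrows_def by metis
    also have "\<dots> = g"
      using g h ident_right unfolding inverse_arrows_def by metis
    finally show ?thesis .
  qed
  then show ?thesis
    unfolding inv_arrow_def using g by (rule theI[rotated])
qed

lemma (in category) cancel_iso_right:
  assumes "iso_arrow C X Y h" "f \<in> Hom C Y Z" "g \<in> Hom C Y Z" "f \<cdot> h = g \<cdot> h"
  shows "f = g"
proof -
  obtain k where k: "h \<in> Hom C X Y" "k \<in> Hom C Y X" "h \<cdot> k = ID Y"
    using assms(1) unfolding iso_arrow_def inverse_arrows_def by blast
  have "f = (f \<cdot> h) \<cdot> k" using cmp_assoc[OF k(2,1) assms(2)] k(3) ident_right[OF assms(2)] by simp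
  also have "\<dots> = g" using cmp_assoc[OF k(2,1) assms(3)] k(3) ident_right[OF assms(3)] assms(4) by simp
  finally show ?thesis .
qed

lemma (in category) cancel_iso_left:
  assumes "iso_arrow C Y Z h" "f \<in> Hom C X Y" "g \<in> Hom C X Y" "h \<cdot> f = h \<cdot> g"
  shows "f = g"
proof -
  obtain k where k: "h \<in> Hom C Y Z" "k \<in> Hom C Z Y" "k \<cdot> h = ID Y"
    using assms(1) unfolding iso_arrow_def inverse_arrows_def by blast
  have "f = k \<cdot> h \<cdot> f" using cmp_assoc[OF assms(2) k(1,2)] k(3) ident_left[OF assms(2)] by simp
  also have "\<dots> = g" using cmp_assoc[OF assms(3) k(1,2)] k(3) ident_left[OF assms(3)] assms(4) by simp
  finally show ?thesis .
qed

text \<open>Five is the number of factors in a hexagon solved for the braiding of a tensor product;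
  this lets such an identity act in front of a further arrow.\<close>

lemma (in category) cmp_assoc5:
  assumes "x \<in> Hom C U V" "p \<in> Hom C V W" "q \<in> Hom C W X" "r \<in> Hom C X Y" "s \<in> Hom C Y Z"
    "t \<in> Hom C Z T"
  shows "(t \<cdot> s \<cdot> r \<cdot> q \<cdot> p) \<cdot> x = t \<cdot> s \<cdot> r \<cdot> q \<cdot> p \<cdot> x"
proof -
  note qp = cmp_Hom[OF assms(2,3)]
  note rqp = cmp_Hom[OF qp assms(4)]
  note srqp = cmp_Hom[OF rqp assms(5)]
  show ?thesis
    by (simp add: cmp_assoc[OF assms(1-3)] cmp_assoc[OF assms(1) qp assms(4)]
        cmp_assoc[OF assms(1) rqp assms(5)] cmp_assoc[OF assms(1) srqp assms(6)])
qed

lemma (in category) iso_arrow_cmp: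
  assumes "iso_arrow C X Y f" "iso_arrow C Y Z g"
  shows "iso_arrow C X Z (g \<cdot> f)"
proof -
  obtain f' where f: "f \<in> Hom C X Y" "f' \<in> Hom C Y X" "f' \<cdot> f = ID X" "f \<cdot> f' = ID Y"
    using assms(1) unfolding iso_arrow_def inverse_arrows_def by blast
  obtain g' where g: "g \<in> Hom C Y Z" "g' \<in> Hom C Z Y" "g' \<cdot> g = ID Y" "g \<cdot> g' = ID Z"
    using assms(2) unfolding iso_arrow_def inverse_arrows_def by blast
  have "(f' \<cdot> g') \<cdot> g \<cdot> f = ID X"
    using cmp_assoc[OF cmp_Hom[OF f(1) g(1)] g(2) f(2)] cmp_assoc[OF f(1) g(1,2)]
      ident_left[OF f(1)] f g by simp
  moreover have "(g \<cdot> f) \<cdot> f' \<cdot> g' = ID Z"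
    using cmp_assoc[OF cmp_Hom[OF g(2) f(2)] f(1) g(1)] cmp_assoc[OF g(2) f(2,1)]
      ident_left[OF g(2)] f g by simp
  ultimately show ?thesis
    using cmp_Hom[OF f(1) g(1)] cmp_Hom[OF g(2) f(2)]
    unfolding iso_arrow_def inverse_arrows_def by blast
qed

text \<open>The embeddings are described by their object maps alone, since on morphisms both
  \<open>J\<close> and \<open>J_Bialg\<close> are the identity.\<close>

definition full_embedding ::
  "('o, 'm, 'y) cat_scheme \<Rightarrow> ('p, 'm, 'z) cat_scheme \<Rightarrow> ('o \<Rightarrow> 'p) \<Rightarrow> bool" where
  "full_embedding C C' j \<longleftrightarrow> category C' \<and> (\<forall>X. X \<in> Obj C \<longleftrightarrow> j X \<in> Obj C') \<and>
     (\<forall>X Y. Hom C X Y = Hom C' (j X) (j Y)) \<and> cmp C = cmp C' \<and>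
     (\<forall>X. ident C X = ident C' (j X))"

lemma full_embedding_Hom:
  "full_embedding C C' j \<Longrightarrow> Hom C X Y = Hom C' (j X) (j Y)"
  unfolding full_embedding_def by blast

text \<open>Every axiom for \<open>C\<close> is literally an axiom of \<open>C'\<close> at objects
  in the image of \<open>j\<close>. This is how \<open>Bialg M\<close> is seen to be a
  category.\<close>

lemma full_embedding_category:
  assumes "full_embedding C C' j"
  shows "category C"
proof -
  interpret C': category C' using assms unfolding full_embedding_def by blast
  note e = assms[unfolded full_embedding_def]
  show ?thesis
    by unfold_locales (use e in \<open>auto simp: C'.ident_Hom C'.ident_left C'.ident_right C'.cmp_assoc
        intro: C'.cmp_Hom dest: C'.Hom_Obj\<close>)
qed

text \<open>Fullness of \<open>k\<close> is what matters: the image under \<open>F'\<close> of an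
  arrow between embedded objects is an arrow between objects \<open>k (fob F X)\<close>, hence
  already an arrow of \<open>D\<close>.\<close>

lemma is_functor_restrict:
  assumes F': "is_functor C' D' F'"
    and j: "full_embedding C C' j" and k: "full_embedding D D' k"
    and Fob: "\<And>X. X \<in> Obj C \<Longrightarrow> k (fob F X) = fob F' (j X)"
    and Fmor: "\<And>X Y f. f \<in> Hom C X Y \<Longrightarrow> fmor F X Y f = fmor F' (j X) (j Y) f"
  shows "is_functor C D F"
proof -
  interpret C: category C using j by (rule full_embedding_category)
  note e = j[unfolded full_embedding_def] k[unfolded full_embedding_def]
  note F = F'[unfolded is_functor_def]
  have mor: "fmor F X Y f \<in> Hom D (fob F X) (fob F Y)" if f: "f \<in> Hom C X Y" for X Y f
    using F e f Fmor[OF f] Fob C.Hom_Obj[OF f] by simp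
  moreover have "fmor F X X (ident C X) = ident D (fob F X)" if X: "X \<in> Obj C" for X
    using F e X Fmor[OF C.ident_Hom[OF X]] Fob by simp
  moreover have "fmor F X Z (cmp C g f) = cmp D (fmor F Y Z g) (fmor F X Y f)"
    if f: "f \<in> Hom C X Y" and g: "g \<in> Hom C Y Z" for X Y Z f g
    using F e f g Fmor[OF f] Fmor[OF g] Fmor[OF C.cmp_Hom[OF f g]] by simp
  moreover have "fob F X \<in> Obj D" if "X \<in> Obj C" for X
    using F e that Fob by simp
  ultimately show ?thesis
    unfolding is_functor_def
    using full_embedding_category[OF j] full_embedding_category[OF k] by blast
qed

text \<open>Whiskering with a functor that is the identity on morphisms only restricts a family to
  the objects; by extensionality such whiskering changes nothing.\<close>

lemma nat_transformation_extensional: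
  "nat_transformation C D F G \<eta> \<Longrightarrow> restrict \<eta> (Obj C) = \<eta>"
  unfolding nat_transformation_def by (auto simp: PiE_def extensional_restrict)

lemma is_functor_Id: "category C \<Longrightarrow> is_functor C C Id_func"
  by (simp add: is_functor_def Id_func_def)

lemma is_functor_comp:
  assumes "is_functor C D F" "is_functor D C' G"
  shows "is_functor C C' (G \<circ>\<^sub>F F)"
proof -
  interpret C: category C using assms unfolding is_functor_def by blast
  show ?thesis
    using assms unfolding is_functor_def comp_func_def by (auto dest: C.Hom_Obj)
qed

lemma nat_transformation_restrict:
  assumes \<eta>': "nat_transformation C' D' F' G' \<eta>'"
    and j: "full_embedding C C' j" and k: "full_embedding D D' k"
    and F: "is_functor C D F" and G: "is_functor C D G"
    and Fob: "\<And>X. X \<in> Obj C \<Longrightarrow> k (fob F X) = fob F' (j X)"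
    and Fmor: "\<And>X Y f. f \<in> Hom C X Y \<Longrightarrow> fmor F X Y f = fmor F' (j X) (j Y) f"
    and Gob: "\<And>X. X \<in> Obj C \<Longrightarrow> k (fob G X) = fob G' (j X)"
    and Gmor: "\<And>X Y f. f \<in> Hom C X Y \<Longrightarrow> fmor G X Y f = fmor G' (j X) (j Y) f"
  shows "nat_transformation C D F G (\<lambda>X\<in>Obj C. \<eta>' (j X))"
proof -
  interpret C: category C using j by (rule full_embedding_category)
  note e = j[unfolded full_embedding_def] k[unfolded full_embedding_def]
  have "\<eta>' (j X) \<in> Hom D (fob F X) (fob G X)" if "X \<in> Obj C" for X
    using \<eta>' e that Fob Gob unfolding nat_transformation_def by (auto simp: PiE_iff)
  moreover have "cmp D (fmor G X Y f) (\<eta>' (j X)) = cmp D (\<eta>' (j Y)) (fmor F X Y f)"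
    if "f \<in> Hom C X Y" for X Y f
    using \<eta>' e that Fmor Gmor unfolding nat_transformation_def by simp
  ultimately show ?thesis
    using F G unfolding nat_transformation_def by (auto dest: C.Hom_Obj)
qed

text \<open>Unit and counit keep their components, and the triangle identities are those of
  \<open>F'\<close> and \<open>G'\<close> evaluated at \<open>j X\<close> and
  \<open>k Y\<close>.\<close>

lemma adjunction_restrict:
  assumes adj: "adjunction C' D' F' G' \<eta>' \<epsilon>'"
    and j: "full_embedding C C' j" and k: "full_embedding D D' k"
    and Fob: "\<And>X. X \<in> Obj C \<Longrightarrow> k (fob F X) = fob F' (j X)"
    and Fmor: "\<And>X Y f. f \<in> Hom C X Y \<Longrightarrow> fmor F X Y f = fmor F' (j X) (j Y) f"
    and Gob: "\<And>Y. Y \<in> Obj D \<Longrightarrow> j (fob G Y) = fob G' (k Y)"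
    and Gmor: "\<And>X Y g. g \<in> Hom D X Y \<Longrightarrow> fmor G X Y g = fmor G' (k X) (k Y) g"
  shows "adjunction C D F G (\<lambda>X\<in>Obj C. \<eta>' (j X)) (\<lambda>Y\<in>Obj D. \<epsilon>' (k Y))"
proof -
  interpret C: category C using j by (rule full_embedding_category)
  interpret D: category D using k by (rule full_embedding_category)
  note e = j[unfolded full_embedding_def] k[unfolded full_embedding_def]
  have F: "is_functor C D F"
    using adj is_functor_restrict[OF _ j k Fob Fmor] unfolding adjunction_def by blast
  have G: "is_functor D C G"
    using adj is_functor_restrict[OF _ k j Gob Gmor] unfolding adjunction_def by blast
  have FX: "fob F X \<in> Obj D" if "X \<in> Obj C" for X
    using F that unfolding is_functor_def by blast
  have GY: "fob G Y \<in> Obj C" if "Y \<in> Obj D" for Y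
    using G that unfolding is_functor_def by blast
  have Fm: "fmor F X Y f \<in> Hom D (fob F X) (fob F Y)" if "f \<in> Hom C X Y" for X Y f
    using F that unfolding is_functor_def by blast
  have Gm: "fmor G X Y f \<in> Hom C (fob G X) (fob G Y)" if "f \<in> Hom D X Y" for X Y f
    using G that unfolding is_functor_def by blast
  have nat_\<eta>: "nat_transformation C C Id_func (G \<circ>\<^sub>F F) (\<lambda>X\<in>Obj C. \<eta>' (j X))"
  proof (rule nat_transformation_restrict[OF _ j j])
    show "nat_transformation C' C' Id_func (G' \<circ>\<^sub>F F') \<eta>'"
      using adj unfolding adjunction_def by blast
    show "is_functor C C Id_func" "is_functor C C (G \<circ>\<^sub>F F)"
      using is_functor_Id is_functor_comp F G C.category_axioms by blast+
  qed (use FX Fm Fob Fmor Gob Gmor C.Hom_Obj in \<open>auto simp: Id_func_def comp_func_def\<close>)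
  have nat_\<epsilon>: "nat_transformation D D (F \<circ>\<^sub>F G) Id_func (\<lambda>Y\<in>Obj D. \<epsilon>' (k Y))"
  proof (rule nat_transformation_restrict[OF _ k k])
    show "nat_transformation D' D' (F' \<circ>\<^sub>F G') Id_func \<epsilon>'"
      using adj unfolding adjunction_def by blast
    show "is_functor D D (F \<circ>\<^sub>F G)" "is_functor D D Id_func"
      using is_functor_Id is_functor_comp F G D.category_axioms by blast+
  qed (use GY Gm Fob Fmor Gob Gmor D.Hom_Obj in \<open>auto simp: Id_func_def comp_func_def\<close>)
  have "cmp D (\<epsilon>' (k (fob F X))) (fmor F X (fob G (fob F X)) (\<eta>' (j X))) = ident D (fob F X)"
    if X: "X \<in> Obj C" for X
  proof -
    \<comment> \<open>\<open>Fmor\<close> speaks of arrows of \<open>C\<close> only, so the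
      component has to be recognized as one before \<open>F\<close> can be traded for
      \<open>F'\<close> on it.\<close>
    have "\<eta>' (j X) \<in> Hom C X (fob G (fob F X))"
      using nat_\<eta> X by (auto simp: nat_transformation_def PiE_iff Id_func_def comp_func_def)
    then have "fmor F X (fob G (fob F X)) (\<eta>' (j X))
        = fmor F' (j X) (fob G' (fob F' (j X))) (\<eta>' (j X))"
      using Fmor Gob Fob FX X by simp
    moreover have "vcomp C' D' (pre_whisker C' \<epsilon>' F')
        (post_whisker C' F' Id_func (G' \<circ>\<^sub>F F') \<eta>') (j X) = ident D' (fob F' (j X))"
      using adj e X unfolding adjunction_def by simp
    ultimately show ?thesis
      using e X Fob by (simp add: vcomp_def pre_whisker_def post_whisker_def Id_func_def comp_func_def)
  qed
  moreover have "cmp C (fmor G (fob F (fob G Y)) Y (\<epsilon>' (k Y))) (\<eta>' (j (fob G Y))) = ident C (fob G Y)"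
    if Y: "Y \<in> Obj D" for Y
  proof -
    have "\<epsilon>' (k Y) \<in> Hom D (fob F (fob G Y)) Y"
      using nat_\<epsilon> Y by (auto simp: nat_transformation_def PiE_iff Id_func_def comp_func_def)
    then have "fmor G (fob F (fob G Y)) Y (\<epsilon>' (k Y))
        = fmor G' (fob F' (fob G' (k Y))) (k Y) (\<epsilon>' (k Y))"
      using Gmor Gob Fob GY Y by simp
    moreover have "vcomp D' C' (post_whisker D' G' (F' \<circ>\<^sub>F G') Id_func \<epsilon>')
        (pre_whisker D' \<eta>' G') (k Y) = ident C' (fob G' (k Y))"
      using adj e Y unfolding adjunction_def by simp
    ultimately show ?thesis
      using e Y Gob by (simp add: vcomp_def pre_whisker_def post_whisker_def Id_func_def comp_func_def)
  qed
  ultimately show ?thesis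
    unfolding adjunction_def using F G nat_\<eta> nat_\<epsilon> FX GY
    by (auto simp: vcomp_def pre_whisker_def post_whisker_def Id_func_def comp_func_def
        intro!: restrict_ext)
qed

section \<open>Coherence of the unit constraints\<close>

context monoidal_category
begin

lemma assoc_inverse:
  assumes "X \<in> Obj M" "Y \<in> Obj M" "Z \<in> Obj M"
  shows "inverse_arrows M (X \<otimes> Y \<otimes> Z) (X \<otimes> (Y \<otimes> Z)) (\<a> X Y Z) (\<a>\<^sup>- X Y Z)"
  unfolding assoc_inv_def by (intro iso_arrow_inverse assoc_iso assms)

lemma assoc_Hom: "X \<in> Obj M \<Longrightarrow> Y \<in> Obj M \<Longrightarrow> Z \<in> Obj M
    \<Longrightarrow> \<a> X Y Z \<in> Hom M (X \<otimes> Y \<otimes> Z) (X \<otimes> (Y \<otimes> Z))"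
  using assoc_inverse unfolding inverse_arrows_def by blast

lemma assoc_inv_Hom: "X \<in> Obj M \<Longrightarrow> Y \<in> Obj M \<Longrightarrow> Z \<in> Obj M
    \<Longrightarrow> \<a>\<^sup>- X Y Z \<in> Hom M (X \<otimes> (Y \<otimes> Z)) (X \<otimes> Y \<otimes> Z)"
  using assoc_inverse unfolding inverse_arrows_def by blast

lemma assoc_inv_iso: "X \<in> Obj M \<Longrightarrow> Y \<in> Obj M \<Longrightarrow> Z \<in> Obj M
    \<Longrightarrow> iso_arrow M (X \<otimes> (Y \<otimes> Z)) (X \<otimes> Y \<otimes> Z) (\<a>\<^sup>- X Y Z)"
  using assoc_inverse unfolding inverse_arrows_def iso_arrow_def by blast

lemma lunit_inverse: "X \<in> Obj M \<Longrightarrow> inverse_arrows M (\<one> \<otimes> X) X (\<l> X) (\<l>\<^sup>- X)"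
  unfolding lunit_inv_def by (intro iso_arrow_inverse lunit_iso)

lemma runit_inverse: "X \<in> Obj M \<Longrightarrow> inverse_arrows M (X \<otimes> \<one>) X (\<r> X) (\<r>\<^sup>- X)"
  unfolding runit_inv_def by (intro iso_arrow_inverse runit_iso)

lemma lunit_Hom: "X \<in> Obj M \<Longrightarrow> \<l> X \<in> Hom M (\<one> \<otimes> X) X"
  using lunit_inverse unfolding inverse_arrows_def by blast

lemma runit_Hom: "X \<in> Obj M \<Longrightarrow> \<r> X \<in> Hom M (X \<otimes> \<one>) X"
  using runit_inverse unfolding inverse_arrows_def by blast

lemma lunit_inv_Hom: "X \<in> Obj M \<Longrightarrow> \<l>\<^sup>- X \<in> Hom M X (\<one> \<otimes> X)"
  using lunit_inverse unfolding inverse_arrows_def by blast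

lemma runit_inv_Hom: "X \<in> Obj M \<Longrightarrow> \<r>\<^sup>- X \<in> Hom M X (X \<otimes> \<one>)"
  using runit_inverse unfolding inverse_arrows_def by blast

text \<open>These rules decide hom-set membership by repeated resolution: in \<open>cmp_Hom\<close>
  the right factor is typed before the left one, which instantiates the unknown middle
  object.\<close>

lemmas typing = cmp_Hom tensor_Hom ident_Hom assoc_Hom assoc_inv_Hom lunit_Hom runit_Hom
  lunit_inv_Hom runit_inv_Hom tensor_Obj unit_Obj

lemma assoc_inv_assoc:
  assumes "X \<in> Obj M" "Y \<in> Obj M" "Z \<in> Obj M"
  shows "\<a>\<^sup>- X Y Z \<cdot> \<a> X Y Z = ID (X \<otimes> Y \<otimes> Z)" "\<a> X Y Z \<cdot> \<a>\<^sup>- X Y Z = ID (X \<otimes> (Y \<otimes> Z))"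
  using assoc_inverse[OF assms] unfolding inverse_arrows_def by auto

lemma assoc_inv_assoc_cmp:
  assumes "X \<in> Obj M" "Y \<in> Obj M" "Z \<in> Obj M" "x \<in> Hom M W (X \<otimes> Y \<otimes> Z)"
  shows "\<a>\<^sup>- X Y Z \<cdot> \<a> X Y Z \<cdot> x = x"
  using cmp_assoc[OF assms(4) assoc_Hom[OF assms(1-3)] assoc_inv_Hom[OF assms(1-3)]]
    assoc_inv_assoc[OF assms(1-3)] ident_left[OF assms(4)] by simp

lemma assoc_assoc_inv_cmp:
  assumes "X \<in> Obj M" "Y \<in> Obj M" "Z \<in> Obj M" "x \<in> Hom M W (X \<otimes> (Y \<otimes> Z))"
  shows "\<a> X Y Z \<cdot> \<a>\<^sup>- X Y Z \<cdot> x = x"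
  using cmp_assoc[OF assms(4) assoc_inv_Hom[OF assms(1-3)] assoc_Hom[OF assms(1-3)]]
    assoc_inv_assoc[OF assms(1-3)] ident_left[OF assms(4)] by simp

lemma tensor_cmp_right:
  assumes "W \<in> Obj M" "f \<in> Hom M X Y" "g \<in> Hom M Y Z"
  shows "ID W \<otimes>\<^sub>m (g \<cdot> f) = (ID W \<otimes>\<^sub>m g) \<cdot> (ID W \<otimes>\<^sub>m f)"
  using tensor_cmp[OF ident_Hom[OF assms(1)] ident_Hom[OF assms(1)] assms(2,3)]
    ident_left[OF ident_Hom[OF assms(1)]] by simp

lemma tensor_cmp_left:
  assumes "W \<in> Obj M" "f \<in> Hom M X Y" "g \<in> Hom M Y Z"
  shows "(g \<cdot> f) \<otimes>\<^sub>m ID W = (g \<otimes>\<^sub>m ID W) \<cdot> (f \<otimes>\<^sub>m ID W)"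
  using tensor_cmp[OF assms(2,3) ident_Hom[OF assms(1)] ident_Hom[OF assms(1)]]
    ident_left[OF ident_Hom[OF assms(1)]] by simp

lemma iso_arrow_tensor_left:
  assumes "iso_arrow M X Y f" and W: "W \<in> Obj M"
  shows "iso_arrow M (X \<otimes> W) (Y \<otimes> W) (f \<otimes>\<^sub>m ID W)"
proof -
  obtain g where g: "f \<in> Hom M X Y" "g \<in> Hom M Y X" "g \<cdot> f = ID X" "f \<cdot> g = ID Y"
    using assms unfolding iso_arrow_def inverse_arrows_def by blast
  then have "inverse_arrows M (X \<otimes> W) (Y \<otimes> W) (f \<otimes>\<^sub>m ID W) (g \<otimes>\<^sub>m ID W)"
    using tensor_cmp_left[OF W g(1,2)] tensor_cmp_left[OF W g(2,1)] W Hom_Obj[OF g(1)]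
    by (simp add: inverse_arrows_def tensor_ident tensor_Hom ident_Hom)
  then show ?thesis unfolding iso_arrow_def by blast
qed

lemma iso_arrow_tensor_right:
  assumes "iso_arrow M X Y f" and W: "W \<in> Obj M"
  shows "iso_arrow M (W \<otimes> X) (W \<otimes> Y) (ID W \<otimes>\<^sub>m f)"
proof -
  obtain g where g: "f \<in> Hom M X Y" "g \<in> Hom M Y X" "g \<cdot> f = ID X" "f \<cdot> g = ID Y"
    using assms unfolding iso_arrow_def inverse_arrows_def by blast
  then have "inverse_arrows M (W \<otimes> X) (W \<otimes> Y) (ID W \<otimes>\<^sub>m f) (ID W \<otimes>\<^sub>m g)"
    using tensor_cmp_right[OF W g(1,2)] tensor_cmp_right[OF W g(2,1)] W Hom_Obj[OF g(1)]
    by (simp add: inverse_arrows_def tensor_ident tensor_Hom ident_Hom)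
  then show ?thesis unfolding iso_arrow_def by blast
qed

text \<open>The interchange law; it reduces questions about both tensor factors to functors of one
  variable, the only ones that the preservation hypotheses mention.\<close>

lemma tensor_split:
  assumes "f \<in> Hom M X X'" "g \<in> Hom M Y Y'"
  shows "f \<otimes>\<^sub>m g = (f \<otimes>\<^sub>m ID Y') \<cdot> (ID X \<otimes>\<^sub>m g)"
  using tensor_cmp[OF ident_Hom assms(1) assms(2) ident_Hom] Hom_Obj[OF assms(1)] Hom_Obj[OF assms(2)]
    ident_left[OF assms(2)] ident_right[OF assms(1)] by simp

text \<open>Naturality of \<open>\<l>\<close> expresses \<open>f \<cdot> \<l> X\<close> through
  \<open>ID \<one> \<otimes>\<^sub>m f\<close>, and \<open>\<l> X\<close> is invertible.\<close>

lemma unit_tensor_faithful: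
  assumes f: "f \<in> Hom M X Y" and g: "g \<in> Hom M X Y" and eq: "ID \<one> \<otimes>\<^sub>m f = ID \<one> \<otimes>\<^sub>m g"
  shows "f = g"
  using cancel_iso_right[OF lunit_iso f g] lunit_natural[OF f] lunit_natural[OF g] eq Hom_Obj[OF f]
  by simp

lemma tensor_unit_faithful:
  assumes f: "f \<in> Hom M X Y" and g: "g \<in> Hom M X Y" and eq: "f \<otimes>\<^sub>m ID \<one> = g \<otimes>\<^sub>m ID \<one>"
  shows "f = g"
  using cancel_iso_right[OF runit_iso f g] runit_natural[OF f] runit_natural[OF g] eq Hom_Obj[OF f]
  by simp

text \<open>Kelly's argument: tensored with the unit object, the claim is the pentagon followed by
  the triangle.\<close>

lemma lunit_tensor:
  assumes X: "X \<in> Obj M" and Y: "Y \<in> Obj M"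
  shows "\<l> (X \<otimes> Y) \<cdot> \<a> \<one> X Y = \<l> X \<otimes>\<^sub>m ID Y"
proof (rule unit_tensor_faithful)
  let ?p = "\<a> \<one> (\<one> \<otimes> X) Y" and ?q = "\<a> \<one> \<one> X \<otimes>\<^sub>m ID Y"
  have p: "?p \<in> Hom M ((\<one> \<otimes> (\<one> \<otimes> X)) \<otimes> Y) (\<one> \<otimes> (\<one> \<otimes> X \<otimes> Y))" by (rule typing X Y)+
  have q: "?q \<in> Hom M ((\<one> \<otimes> \<one> \<otimes> X) \<otimes> Y) ((\<one> \<otimes> (\<one> \<otimes> X)) \<otimes> Y)" by (rule typing X Y)+
  show "\<l> (X \<otimes> Y) \<cdot> \<a> \<one> X Y \<in> Hom M (\<one> \<otimes> X \<otimes> Y) (X \<otimes> Y)" by (rule typing X Y)+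
  show "\<l> X \<otimes>\<^sub>m ID Y \<in> Hom M (\<one> \<otimes> X \<otimes> Y) (X \<otimes> Y)" by (rule typing X Y)+
  \<comment> \<open>The arrow \<open>?p \<cdot> ?q\<close> is the tail of the pentagon on
    \<open>\<one>, \<one>, X, Y\<close>. Being invertible, it can be appended to both sides and
    cancelled at the end.\<close>
  have iso_pq: "iso_arrow M ((\<one> \<otimes> \<one> \<otimes> X) \<otimes> Y) (\<one> \<otimes> (\<one> \<otimes> X \<otimes> Y)) (?p \<cdot> ?q)"
    by (rule iso_arrow_cmp iso_arrow_tensor_left assoc_iso typing X Y)+
  have "(ID \<one> \<otimes>\<^sub>m (\<l> (X \<otimes> Y) \<cdot> \<a> \<one> X Y)) \<cdot> ?p \<cdot> ?q
      = (ID \<one> \<otimes>\<^sub>m \<l> (X \<otimes> Y)) \<cdot> (ID \<one> \<otimes>\<^sub>m \<a> \<one> X Y) \<cdot> ?p \<cdot> ?q"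
    unfolding tensor_cmp_right[OF unit_Obj assoc_Hom[OF unit_Obj X Y] lunit_Hom[OF tensor_Obj[OF X Y]]]
    by (rule cmp_assoc) (rule typing X Y)+
  also have "\<dots> = (ID \<one> \<otimes>\<^sub>m \<l> (X \<otimes> Y)) \<cdot> \<a> \<one> \<one> (X \<otimes> Y) \<cdot> \<a> (\<one> \<otimes> \<one>) X Y"
    by (simp add: pentagon X Y unit_Obj)
  also have "\<dots> = ((ID \<one> \<otimes>\<^sub>m \<l> (X \<otimes> Y)) \<cdot> \<a> \<one> \<one> (X \<otimes> Y)) \<cdot> \<a> (\<one> \<otimes> \<one>) X Y"
    by (rule cmp_assoc[symmetric]) (rule typing X Y)+
  also have "\<dots> = (\<r> \<one> \<otimes>\<^sub>m (ID X \<otimes>\<^sub>m ID Y)) \<cdot> \<a> (\<one> \<otimes> \<one>) X Y"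
    by (simp add: triangle X Y unit_Obj tensor_Obj tensor_ident)
  also have "\<dots> = \<a> \<one> X Y \<cdot> ((\<r> \<one> \<otimes>\<^sub>m ID X) \<otimes>\<^sub>m ID Y)"
    by (rule assoc_natural[symmetric]) (rule typing X Y)+
  also have "(\<r> \<one> \<otimes>\<^sub>m ID X) \<otimes>\<^sub>m ID Y = ((ID \<one> \<otimes>\<^sub>m \<l> X) \<otimes>\<^sub>m ID Y) \<cdot> ?q"
    unfolding triangle[OF unit_Obj X, symmetric] by (rule tensor_cmp_left) (rule typing X Y)+
  also have "\<a> \<one> X Y \<cdot> \<dots> = (\<a> \<one> X Y \<cdot> ((ID \<one> \<otimes>\<^sub>m \<l> X) \<otimes>\<^sub>m ID Y)) \<cdot> ?q"
    by (rule cmp_assoc[symmetric]) (rule typing X Y)+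
  also have "\<a> \<one> X Y \<cdot> ((ID \<one> \<otimes>\<^sub>m \<l> X) \<otimes>\<^sub>m ID Y) = (ID \<one> \<otimes>\<^sub>m (\<l> X \<otimes>\<^sub>m ID Y)) \<cdot> ?p"
    by (rule assoc_natural) (rule typing X Y)+
  also have "\<dots> \<cdot> ?q = (ID \<one> \<otimes>\<^sub>m (\<l> X \<otimes>\<^sub>m ID Y)) \<cdot> ?p \<cdot> ?q"
    by (rule cmp_assoc[OF q p]) (rule typing X Y)+
  finally show "ID \<one> \<otimes>\<^sub>m (\<l> (X \<otimes> Y) \<cdot> \<a> \<one> X Y) = ID \<one> \<otimes>\<^sub>m (\<l> X \<otimes>\<^sub>m ID Y)"
    by (rule cancel_iso_right[OF iso_pq, rotated 2]) (rule typing X Y)+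
qed

text \<open>The mirror image of \<open>lunit_tensor\<close>, with the pentagon on
  \<open>X, Y, \<one>, \<one>\<close> and the claim tensored with the unit from the right. Here the
  invertible arrow to be cancelled, \<open>\<a> X Y \<one>\<close>, stands on the left.\<close>

lemma runit_tensor:
  assumes X: "X \<in> Obj M" and Y: "Y \<in> Obj M"
  shows "(ID X \<otimes>\<^sub>m \<r> Y) \<cdot> \<a> X Y \<one> = \<r> (X \<otimes> Y)"
proof (rule tensor_unit_faithful[OF _ _ cancel_iso_left])
  let ?a = "\<a> X Y \<one>"
  have r: "ID X \<otimes>\<^sub>m \<r> Y \<in> Hom M (X \<otimes> (Y \<otimes> \<one>)) (X \<otimes> Y)" by (rule typing X Y)+
  show "iso_arrow M (X \<otimes> Y \<otimes> \<one>) (X \<otimes> (Y \<otimes> \<one>)) ?a" by (rule assoc_iso X Y typing)+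
  show "(ID X \<otimes>\<^sub>m \<r> Y) \<cdot> ?a \<in> Hom M (X \<otimes> Y \<otimes> \<one>) (X \<otimes> Y)"
    and "\<r> (X \<otimes> Y) \<in> Hom M (X \<otimes> Y \<otimes> \<one>) (X \<otimes> Y)" by (rule typing X Y)+
  show "((ID X \<otimes>\<^sub>m \<r> Y) \<cdot> ?a) \<otimes>\<^sub>m ID \<one> \<in> Hom M (X \<otimes> Y \<otimes> \<one> \<otimes> \<one>) (X \<otimes> Y \<otimes> \<one>)"
    and "\<r> (X \<otimes> Y) \<otimes>\<^sub>m ID \<one> \<in> Hom M (X \<otimes> Y \<otimes> \<one> \<otimes> \<one>) (X \<otimes> Y \<otimes> \<one>)" by (rule typing X Y)+
  have "?a \<cdot> (((ID X \<otimes>\<^sub>m \<r> Y) \<cdot> ?a) \<otimes>\<^sub>m ID \<one>)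
      = ?a \<cdot> ((ID X \<otimes>\<^sub>m \<r> Y) \<otimes>\<^sub>m ID \<one>) \<cdot> (?a \<otimes>\<^sub>m ID \<one>)"
    by (subst tensor_cmp_left[OF unit_Obj _ r]) (rule typing X Y refl)+
  also have "\<dots> = (?a \<cdot> ((ID X \<otimes>\<^sub>m \<r> Y) \<otimes>\<^sub>m ID \<one>)) \<cdot> (?a \<otimes>\<^sub>m ID \<one>)"
    by (rule cmp_assoc[symmetric]) (rule typing X Y)+
  also have "?a \<cdot> ((ID X \<otimes>\<^sub>m \<r> Y) \<otimes>\<^sub>m ID \<one>) = (ID X \<otimes>\<^sub>m (\<r> Y \<otimes>\<^sub>m ID \<one>)) \<cdot> \<a> X (Y \<otimes> \<one>) \<one>"
    by (rule assoc_natural) (rule typing X Y)+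
  also have "ID X \<otimes>\<^sub>m (\<r> Y \<otimes>\<^sub>m ID \<one>) = (ID X \<otimes>\<^sub>m (ID Y \<otimes>\<^sub>m \<l> \<one>)) \<cdot> (ID X \<otimes>\<^sub>m \<a> Y \<one> \<one>)"
    unfolding triangle[OF Y unit_Obj, symmetric] by (rule tensor_cmp_right) (rule typing X Y)+
  also have "(\<dots> \<cdot> \<a> X (Y \<otimes> \<one>) \<one>) \<cdot> (?a \<otimes>\<^sub>m ID \<one>)
      = ((ID X \<otimes>\<^sub>m (ID Y \<otimes>\<^sub>m \<l> \<one>)) \<cdot> (ID X \<otimes>\<^sub>m \<a> Y \<one> \<one>)) \<cdot> \<a> X (Y \<otimes> \<one>) \<one> \<cdot> (?a \<otimes>\<^sub>m ID \<one>)"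
    by (rule cmp_assoc) (rule typing X Y)+
  also have "\<dots> = (ID X \<otimes>\<^sub>m (ID Y \<otimes>\<^sub>m \<l> \<one>)) \<cdot> (ID X \<otimes>\<^sub>m \<a> Y \<one> \<one>) \<cdot> \<a> X (Y \<otimes> \<one>) \<one> \<cdot> (?a \<otimes>\<^sub>m ID \<one>)"
    by (rule cmp_assoc) (rule typing X Y)+
  also have "\<dots> = (ID X \<otimes>\<^sub>m (ID Y \<otimes>\<^sub>m \<l> \<one>)) \<cdot> \<a> X Y (\<one> \<otimes> \<one>) \<cdot> \<a> (X \<otimes> Y) \<one> \<one>"
    by (simp add: pentagon X Y unit_Obj)
  also have "\<dots> = ((ID X \<otimes>\<^sub>m (ID Y \<otimes>\<^sub>m \<l> \<one>)) \<cdot> \<a> X Y (\<one> \<otimes> \<one>)) \<cdot> \<a> (X \<otimes> Y) \<one> \<one>"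
    by (rule cmp_assoc[symmetric]) (rule typing X Y)+
  also have "(ID X \<otimes>\<^sub>m (ID Y \<otimes>\<^sub>m \<l> \<one>)) \<cdot> \<a> X Y (\<one> \<otimes> \<one>) = ?a \<cdot> ((ID X \<otimes>\<^sub>m ID Y) \<otimes>\<^sub>m \<l> \<one>)"
    by (rule assoc_natural[symmetric]) (rule typing X Y)+
  also have "\<dots> \<cdot> \<a> (X \<otimes> Y) \<one> \<one> = ?a \<cdot> ((ID X \<otimes>\<^sub>m ID Y) \<otimes>\<^sub>m \<l> \<one>) \<cdot> \<a> (X \<otimes> Y) \<one> \<one>"
    by (rule cmp_assoc) (rule typing X Y)+
  also have "\<dots> = ?a \<cdot> (\<r> (X \<otimes> Y) \<otimes>\<^sub>m ID \<one>)"
    by (simp add: triangle X Y unit_Obj tensor_Obj tensor_ident)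
  finally show "?a \<cdot> (((ID X \<otimes>\<^sub>m \<r> Y) \<cdot> ?a) \<otimes>\<^sub>m ID \<one>) = ?a \<cdot> (\<r> (X \<otimes> Y) \<otimes>\<^sub>m ID \<one>)" .
qed

end

section \<open>The braiding\<close>

context braided_monoidal_category
begin

lemma braiding_Hom: "X \<in> Obj M \<Longrightarrow> Y \<in> Obj M \<Longrightarrow> \<c> X Y \<in> Hom M (X \<otimes> Y) (Y \<otimes> X)"
  using braiding_iso unfolding iso_arrow_def inverse_arrows_def by blast

lemmas btyping = typing braiding_Hom

text \<open>This is \<open>hexagon2\<close> solved for the braiding, bracketed as in the axioms of
  braided algebras and of \<open>is_cT_family\<close>, so that those composites collapse by plain
  rewriting.\<close>

lemma braiding_left:
  assumes X: "X \<in> Obj M" and Y: "Y \<in> Obj M" and Z: "Z \<in> Obj M"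
  shows "\<a> Z X Y \<cdot> (\<c> X Z \<otimes>\<^sub>m ID Y) \<cdot> \<a>\<^sup>- X Z Y \<cdot> (ID X \<otimes>\<^sub>m \<c> Y Z) \<cdot> \<a> X Y Z = \<c> (X \<otimes> Y) Z"
proof -
  let ?h = "(\<c> X Z \<otimes>\<^sub>m ID Y) \<cdot> \<a>\<^sup>- X Z Y \<cdot> (ID X \<otimes>\<^sub>m \<c> Y Z)"
  have "\<a> Z X Y \<cdot> (\<c> X Z \<otimes>\<^sub>m ID Y) \<cdot> \<a>\<^sup>- X Z Y \<cdot> (ID X \<otimes>\<^sub>m \<c> Y Z) \<cdot> \<a> X Y Z
      = \<a> Z X Y \<cdot> (\<c> X Z \<otimes>\<^sub>m ID Y) \<cdot> (\<a>\<^sup>- X Z Y \<cdot> (ID X \<otimes>\<^sub>m \<c> Y Z)) \<cdot> \<a> X Y Z"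
    by (subst cmp_assoc) (rule btyping X Y Z refl)+
  also have "\<dots> = \<a> Z X Y \<cdot> ?h \<cdot> \<a> X Y Z"
    by (subst (2) cmp_assoc) (rule btyping X Y Z refl)+
  also have "\<dots> = \<a> Z X Y \<cdot> (\<a>\<^sup>- Z X Y \<cdot> \<c> (X \<otimes> Y) Z \<cdot> \<a>\<^sup>- X Y Z) \<cdot> \<a> X Y Z"
    by (simp add: hexagon2 X Y Z)
  also have "\<dots> = \<a> Z X Y \<cdot> \<a>\<^sup>- Z X Y \<cdot> (\<c> (X \<otimes> Y) Z \<cdot> \<a>\<^sup>- X Y Z) \<cdot> \<a> X Y Z"
    by (subst cmp_assoc) (rule btyping X Y Z refl)+
  also have "\<dots> = (\<c> (X \<otimes> Y) Z \<cdot> \<a>\<^sup>- X Y Z) \<cdot> \<a> X Y Z"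
    by (rule assoc_assoc_inv_cmp) (rule btyping X Y Z)+
  also have "\<dots> = \<c> (X \<otimes> Y) Z \<cdot> \<a>\<^sup>- X Y Z \<cdot> \<a> X Y Z"
    by (rule cmp_assoc) (rule btyping X Y Z)+
  also have "\<dots> = \<c> (X \<otimes> Y) Z"
    using X Y Z by (simp add: assoc_inv_assoc ident_right[OF braiding_Hom] tensor_Obj)
  finally show ?thesis .
qed

lemma braiding_right:
  assumes X: "X \<in> Obj M" and Y: "Y \<in> Obj M" and Z: "Z \<in> Obj M"
  shows "\<a>\<^sup>- Y Z X \<cdot> (ID Y \<otimes>\<^sub>m \<c> X Z) \<cdot> \<a> Y X Z \<cdot> (\<c> X Y \<otimes>\<^sub>m ID Z) \<cdot> \<a>\<^sup>- X Y Z = \<c> X (Y \<otimes> Z)"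
proof -
  let ?h = "(ID Y \<otimes>\<^sub>m \<c> X Z) \<cdot> \<a> Y X Z \<cdot> (\<c> X Y \<otimes>\<^sub>m ID Z)"
  have "\<a>\<^sup>- Y Z X \<cdot> (ID Y \<otimes>\<^sub>m \<c> X Z) \<cdot> \<a> Y X Z \<cdot> (\<c> X Y \<otimes>\<^sub>m ID Z) \<cdot> \<a>\<^sup>- X Y Z
      = \<a>\<^sup>- Y Z X \<cdot> (ID Y \<otimes>\<^sub>m \<c> X Z) \<cdot> (\<a> Y X Z \<cdot> (\<c> X Y \<otimes>\<^sub>m ID Z)) \<cdot> \<a>\<^sup>- X Y Z"
    by (subst cmp_assoc) (rule btyping X Y Z refl)+
  also have "\<dots> = \<a>\<^sup>- Y Z X \<cdot> ?h \<cdot> \<a>\<^sup>- X Y Z"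
    by (subst (2) cmp_assoc) (rule btyping X Y Z refl)+
  also have "\<dots> = \<a>\<^sup>- Y Z X \<cdot> (\<a> Y Z X \<cdot> \<c> X (Y \<otimes> Z) \<cdot> \<a> X Y Z) \<cdot> \<a>\<^sup>- X Y Z"
    by (simp add: hexagon1 X Y Z)
  also have "\<dots> = \<a>\<^sup>- Y Z X \<cdot> \<a> Y Z X \<cdot> (\<c> X (Y \<otimes> Z) \<cdot> \<a> X Y Z) \<cdot> \<a>\<^sup>- X Y Z"
    by (subst cmp_assoc) (rule btyping X Y Z refl)+
  also have "\<dots> = (\<c> X (Y \<otimes> Z) \<cdot> \<a> X Y Z) \<cdot> \<a>\<^sup>- X Y Z"
    by (rule assoc_inv_assoc_cmp) (rule btyping X Y Z)+
  also have "\<dots> = \<c> X (Y \<otimes> Z) \<cdot> \<a> X Y Z \<cdot> \<a>\<^sup>- X Y Z"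
    by (rule cmp_assoc) (rule btyping X Y Z)+
  also have "\<dots> = \<c> X (Y \<otimes> Z)"
    using X Y Z by (simp add: assoc_inv_assoc ident_right[OF braiding_Hom] tensor_Obj)
  finally show ?thesis .
qed

text \<open>Composition nests to the right, so \<open>braiding_left\<close> matches only at the end
  of a chain; this form serves chains that continue, as in the coalgebra axioms and the Yang-Baxter
  equation.\<close>

lemma braiding_left_cmp:
  assumes X: "X \<in> Obj M" and Y: "Y \<in> Obj M" and Z: "Z \<in> Obj M" and x: "x \<in> Hom M W (X \<otimes> Y \<otimes> Z)"
  shows "\<a> Z X Y \<cdot> (\<c> X Z \<otimes>\<^sub>m ID Y) \<cdot> \<a>\<^sup>- X Z Y \<cdot> (ID X \<otimes>\<^sub>m \<c> Y Z) \<cdot> \<a> X Y Z \<cdot> x = \<c> (X \<otimes> Y) Z \<cdot> x"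
  unfolding braiding_left[OF X Y Z, symmetric]
  by (rule cmp_assoc5[OF x, symmetric]) (rule btyping X Y Z)+

lemma braiding_right_cmp:
  assumes X: "X \<in> Obj M" and Y: "Y \<in> Obj M" and Z: "Z \<in> Obj M" and x: "x \<in> Hom M W (X \<otimes> (Y \<otimes> Z))"
  shows "\<a>\<^sup>- Y Z X \<cdot> (ID Y \<otimes>\<^sub>m \<c> X Z) \<cdot> \<a> Y X Z \<cdot> (\<c> X Y \<otimes>\<^sub>m ID Z) \<cdot> \<a>\<^sup>- X Y Z \<cdot> x = \<c> X (Y \<otimes> Z) \<cdot> x"
  unfolding braiding_right[OF X Y Z, symmetric]
  by (rule cmp_assoc5[OF x, symmetric]) (rule btyping X Y Z)+

text \<open>Both sides are the two ways of writing the naturality square of the braiding for the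
  morphism \<open>\<c> X Y\<close>.\<close>

lemma yang_baxter:
  assumes X: "X \<in> Obj M" and Y: "Y \<in> Obj M" and Z: "Z \<in> Obj M"
  shows "(ID Z \<otimes>\<^sub>m \<c> X Y) \<cdot> \<a> Z X Y \<cdot> (\<c> X Z \<otimes>\<^sub>m ID Y) \<cdot> \<a>\<^sup>- X Z Y \<cdot> (ID X \<otimes>\<^sub>m \<c> Y Z) \<cdot> \<a> X Y Z
    = \<a> Z Y X \<cdot> (\<c> Y Z \<otimes>\<^sub>m ID X) \<cdot> \<a>\<^sup>- Y Z X \<cdot> (ID Y \<otimes>\<^sub>m \<c> X Z) \<cdot> \<a> Y X Z \<cdot> (\<c> X Y \<otimes>\<^sub>m ID Z)"
proof -
  have "\<c> X Y \<otimes>\<^sub>m ID Z \<in> Hom M (X \<otimes> Y \<otimes> Z) (Y \<otimes> X \<otimes> Z)" by (rule btyping X Y Z)+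
  then show ?thesis
    by (simp add: braiding_left X Y Z braiding_left_cmp braiding_natural[OF braiding_Hom ident_Hom])
qed

lemma braided_object_braiding:
  assumes V: "V \<in> Obj M"
  shows "is_braided_object M V (\<c> V V)"
proof -
  let ?a = "\<a> V V V" and ?a' = "\<a>\<^sup>- V V V" and ?p = "ID V \<otimes>\<^sub>m \<c> V V" and ?q = "\<c> V V \<otimes>\<^sub>m ID V"
  have "(?a' \<cdot> ?p \<cdot> ?a) \<cdot> ?q = ?a' \<cdot> (?p \<cdot> ?a) \<cdot> ?q"
    by (rule cmp_assoc) (rule btyping V)+
  also have "(?p \<cdot> ?a) \<cdot> ?q = ?p \<cdot> ?a \<cdot> ?q"
    by (rule cmp_assoc) (rule btyping V)+
  finally have "?q \<cdot> (?a' \<cdot> ?p \<cdot> ?a) \<cdot> ?q = ?q \<cdot> ?a' \<cdot> ?p \<cdot> ?a \<cdot> ?q"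
    by simp
  \<comment> \<open>\<open>yang_baxter\<close> ends in \<open>V \<otimes> (V \<otimes> V)\<close>,
    whereas \<open>is_braided_object\<close> stays on \<open>(V \<otimes> V) \<otimes> V\<close>;
    the inserted pair of constraints bridges the two.\<close>
  also have "\<dots> = ?a' \<cdot> ?a \<cdot> ?q \<cdot> ?a' \<cdot> ?p \<cdot> ?a \<cdot> ?q"
    by (rule assoc_inv_assoc_cmp[symmetric]) (rule btyping V)+
  also have "\<dots> = ?a' \<cdot> ?p \<cdot> ?a \<cdot> ?q \<cdot> ?a' \<cdot> ?p \<cdot> ?a"
    using yang_baxter[OF V V V] by simp
  also have "?p \<cdot> ?a \<cdot> ?q \<cdot> ?a' \<cdot> ?p \<cdot> ?a = (?p \<cdot> ?a) \<cdot> ?q \<cdot> ?a' \<cdot> ?p \<cdot> ?a"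
    by (rule cmp_assoc[symmetric]) (rule btyping V)+
  also have "?a' \<cdot> \<dots> = (?a' \<cdot> ?p \<cdot> ?a) \<cdot> ?q \<cdot> ?a' \<cdot> ?p \<cdot> ?a"
    by (rule cmp_assoc[symmetric]) (rule btyping V)+
  finally show ?thesis
    unfolding is_braided_object_def Let_def using V braiding_iso[OF V V] by blast
qed

text \<open>Tensored with the unit from the left, both sides agree after the invertible arrow
  \<open>\<a> \<one> X \<one> \<cdot> (\<c> X \<one> \<otimes>\<^sub>m ID \<one>)\<close>. This
  follows from \<open>hexagon1\<close> on \<open>X, \<one>, \<one>\<close>, the triangle, naturality
  of the braiding along \<open>\<r> \<one>\<close>, and \<open>runit_tensor\<close>.\<close>

lemma lunit_braiding:
  assumes X: "X \<in> Obj M"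
  shows "\<l> X \<cdot> \<c> X \<one> = \<r> X"
proof (rule unit_tensor_faithful)
  let ?c = "\<c> X \<one>"
  have c: "?c \<in> Hom M (X \<otimes> \<one>) (\<one> \<otimes> X)" by (rule btyping X)+
  show "\<l> X \<cdot> ?c \<in> Hom M (X \<otimes> \<one>) X" "\<r> X \<in> Hom M (X \<otimes> \<one>) X" by (rule btyping X)+
  have iso: "iso_arrow M (X \<otimes> \<one> \<otimes> \<one>) (\<one> \<otimes> (X \<otimes> \<one>)) (\<a> \<one> X \<one> \<cdot> (?c \<otimes>\<^sub>m ID \<one>))"
    by (rule iso_arrow_cmp iso_arrow_tensor_left assoc_iso braiding_iso X unit_Obj)+
  have "(ID \<one> \<otimes>\<^sub>m (\<l> X \<cdot> ?c)) \<cdot> \<a> \<one> X \<one> \<cdot> (?c \<otimes>\<^sub>m ID \<one>)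
      = (ID \<one> \<otimes>\<^sub>m \<l> X) \<cdot> (ID \<one> \<otimes>\<^sub>m ?c) \<cdot> \<a> \<one> X \<one> \<cdot> (?c \<otimes>\<^sub>m ID \<one>)"
    unfolding tensor_cmp_right[OF unit_Obj c lunit_Hom[OF X]]
    by (rule cmp_assoc) (rule btyping X)+
  also have "\<dots> = (ID \<one> \<otimes>\<^sub>m \<l> X) \<cdot> \<a> \<one> \<one> X \<cdot> \<c> X (\<one> \<otimes> \<one>) \<cdot> \<a> X \<one> \<one>"
    by (simp add: hexagon1 X unit_Obj)
  also have "\<dots> = ((ID \<one> \<otimes>\<^sub>m \<l> X) \<cdot> \<a> \<one> \<one> X) \<cdot> \<c> X (\<one> \<otimes> \<one>) \<cdot> \<a> X \<one> \<one>"
    by (rule cmp_assoc[symmetric]) (rule btyping X)+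
  also have "\<dots> = (\<r> \<one> \<otimes>\<^sub>m ID X) \<cdot> \<c> X (\<one> \<otimes> \<one>) \<cdot> \<a> X \<one> \<one>"
    by (simp add: triangle X unit_Obj)
  also have "\<dots> = ((\<r> \<one> \<otimes>\<^sub>m ID X) \<cdot> \<c> X (\<one> \<otimes> \<one>)) \<cdot> \<a> X \<one> \<one>"
    by (rule cmp_assoc[symmetric]) (rule btyping X)+
  also have "(\<r> \<one> \<otimes>\<^sub>m ID X) \<cdot> \<c> X (\<one> \<otimes> \<one>) = ?c \<cdot> (ID X \<otimes>\<^sub>m \<r> \<one>)"
    by (rule braiding_natural[symmetric]) (rule btyping X)+
  also have "\<dots> \<cdot> \<a> X \<one> \<one> = ?c \<cdot> (ID X \<otimes>\<^sub>m \<r> \<one>) \<cdot> \<a> X \<one> \<one>"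
    by (rule cmp_assoc) (rule btyping X)+
  also have "\<dots> = \<r> (\<one> \<otimes> X) \<cdot> (?c \<otimes>\<^sub>m ID \<one>)"
    by (simp add: runit_tensor X unit_Obj runit_natural[OF c])
  also have "\<dots> = (ID \<one> \<otimes>\<^sub>m \<r> X) \<cdot> \<a> \<one> X \<one> \<cdot> (?c \<otimes>\<^sub>m ID \<one>)"
    unfolding runit_tensor[OF unit_Obj X, symmetric] by (rule cmp_assoc) (rule btyping X)+
  finally show "ID \<one> \<otimes>\<^sub>m (\<l> X \<cdot> ?c) = ID \<one> \<otimes>\<^sub>m \<r> X"
    by (rule cancel_iso_right[OF iso, rotated 2]) (rule btyping X)+
qed

text \<open>The mirror argument, with the second hexagon on \<open>\<one>, \<one>, X\<close> and
  \<open>lunit_tensor\<close>. It cannot be read off from \<open>lunit_braiding\<close>, since the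
  braiding need not be symmetric.\<close>

lemma runit_braiding:
  assumes X: "X \<in> Obj M"
  shows "\<r> X \<cdot> \<c> \<one> X = \<l> X"
proof (rule tensor_unit_faithful)
  let ?c = "\<c> \<one> X"
  have c: "?c \<in> Hom M (\<one> \<otimes> X) (X \<otimes> \<one>)" by (rule btyping X)+
  show "\<r> X \<cdot> ?c \<in> Hom M (\<one> \<otimes> X) X" "\<l> X \<in> Hom M (\<one> \<otimes> X) X" by (rule btyping X)+
  have iso: "iso_arrow M (\<one> \<otimes> \<one> \<otimes> X) (\<one> \<otimes> X \<otimes> \<one>) (\<a>\<^sup>- \<one> X \<one> \<cdot> (ID \<one> \<otimes>\<^sub>m ?c) \<cdot> \<a> \<one> \<one> X)"
    by (rule iso_arrow_cmp assoc_inv_iso iso_arrow_tensor_right assoc_iso braiding_iso X unit_Obj)+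
  have "((\<r> X \<cdot> ?c) \<otimes>\<^sub>m ID \<one>) \<cdot> \<a>\<^sup>- \<one> X \<one> \<cdot> (ID \<one> \<otimes>\<^sub>m ?c) \<cdot> \<a> \<one> \<one> X
      = (\<r> X \<otimes>\<^sub>m ID \<one>) \<cdot> (?c \<otimes>\<^sub>m ID \<one>) \<cdot> \<a>\<^sup>- \<one> X \<one> \<cdot> (ID \<one> \<otimes>\<^sub>m ?c) \<cdot> \<a> \<one> \<one> X"
    unfolding tensor_cmp_left[OF unit_Obj c runit_Hom[OF X]]
    by (rule cmp_assoc) (rule btyping X)+
  also have "\<dots> = ((ID X \<otimes>\<^sub>m \<l> \<one>) \<cdot> \<a> X \<one> \<one>) \<cdot> (?c \<otimes>\<^sub>m ID \<one>) \<cdot> \<a>\<^sup>- \<one> X \<one> \<cdot> (ID \<one> \<otimes>\<^sub>m ?c) \<cdot> \<a> \<one> \<one> X"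
    by (simp add: triangle X unit_Obj)
  also have "\<dots> = (ID X \<otimes>\<^sub>m \<l> \<one>) \<cdot> \<a> X \<one> \<one> \<cdot> (?c \<otimes>\<^sub>m ID \<one>) \<cdot> \<a>\<^sup>- \<one> X \<one> \<cdot> (ID \<one> \<otimes>\<^sub>m ?c) \<cdot> \<a> \<one> \<one> X"
    by (rule cmp_assoc) (rule btyping X)+
  also have "\<dots> = (ID X \<otimes>\<^sub>m \<l> \<one>) \<cdot> \<c> (\<one> \<otimes> \<one>) X"
    by (simp add: braiding_left X unit_Obj)
  also have "\<dots> = ?c \<cdot> (\<l> \<one> \<otimes>\<^sub>m ID X)"
    by (rule braiding_natural[symmetric]) (rule btyping X)+
  also have "\<dots> = ?c \<cdot> \<l> (\<one> \<otimes> X) \<cdot> \<a> \<one> \<one> X"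
    by (simp add: lunit_tensor X unit_Obj)
  also have "\<dots> = (?c \<cdot> \<l> (\<one> \<otimes> X)) \<cdot> \<a> \<one> \<one> X"
    by (rule cmp_assoc[symmetric]) (rule btyping X)+
  also have "\<dots> = (\<l> (X \<otimes> \<one>) \<cdot> (ID \<one> \<otimes>\<^sub>m ?c)) \<cdot> \<a> \<one> \<one> X"
    by (simp add: lunit_natural[OF c])
  also have "\<dots> = \<l> (X \<otimes> \<one>) \<cdot> (ID \<one> \<otimes>\<^sub>m ?c) \<cdot> \<a> \<one> \<one> X"
    by (rule cmp_assoc) (rule btyping X)+
  \<comment> \<open>The inserted pair serves twice: its left half feeds \<open>lunit_tensor\<close>,
    its right half completes the invertible tail that is cancelled at the end.\<close>
  also have "\<dots> = \<l> (X \<otimes> \<one>) \<cdot> \<a> \<one> X \<one> \<cdot> \<a>\<^sup>- \<one> X \<one> \<cdot> (ID \<one> \<otimes>\<^sub>m ?c) \<cdot> \<a> \<one> \<one> X"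
    by (subst assoc_assoc_inv_cmp) (rule btyping X refl)+
  also have "\<dots> = (\<l> (X \<otimes> \<one>) \<cdot> \<a> \<one> X \<one>) \<cdot> \<a>\<^sup>- \<one> X \<one> \<cdot> (ID \<one> \<otimes>\<^sub>m ?c) \<cdot> \<a> \<one> \<one> X"
    by (rule cmp_assoc[symmetric]) (rule btyping X)+
  also have "\<dots> = (\<l> X \<otimes>\<^sub>m ID \<one>) \<cdot> \<a>\<^sup>- \<one> X \<one> \<cdot> (ID \<one> \<otimes>\<^sub>m ?c) \<cdot> \<a> \<one> \<one> X"
    by (simp add: lunit_tensor X unit_Obj)
  finally show "(\<r> X \<cdot> ?c) \<otimes>\<^sub>m ID \<one> = \<l> X \<otimes>\<^sub>m ID \<one>"
    by (rule cancel_iso_right[OF iso, rotated 2]) (rule btyping X)+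
qed

lemma braiding_lunit_inv:
  assumes X: "X \<in> Obj M"
  shows "\<c> \<one> X \<cdot> \<l>\<^sup>- X = \<r>\<^sup>- X"
proof (rule cancel_iso_left[OF runit_iso[OF X]])
  have "\<r> X \<cdot> \<c> \<one> X \<cdot> \<l>\<^sup>- X = (\<r> X \<cdot> \<c> \<one> X) \<cdot> \<l>\<^sup>- X"
    by (rule cmp_assoc[symmetric]) (rule btyping X)+
  then show "\<r> X \<cdot> \<c> \<one> X \<cdot> \<l>\<^sup>- X = \<r> X \<cdot> \<r>\<^sup>- X"
    using runit_braiding[OF X] lunit_inverse[OF X] runit_inverse[OF X]
    unfolding inverse_arrows_def by simp
qed (rule btyping X)+

lemma braiding_runit_inv:
  assumes X: "X \<in> Obj M"
  shows "\<c> X \<one> \<cdot> \<r>\<^sup>- X = \<l>\<^sup>- X"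
proof (rule cancel_iso_left[OF lunit_iso[OF X]])
  have "\<l> X \<cdot> \<c> X \<one> \<cdot> \<r>\<^sup>- X = (\<l> X \<cdot> \<c> X \<one>) \<cdot> \<r>\<^sup>- X"
    by (rule cmp_assoc[symmetric]) (rule btyping X)+
  then show "\<l> X \<cdot> \<c> X \<one> \<cdot> \<r>\<^sup>- X = \<l> X \<cdot> \<l>\<^sup>- X"
    using lunit_braiding[OF X] lunit_inverse[OF X] runit_inverse[OF X]
    unfolding inverse_arrows_def by simp
qed (rule btyping X)+

text \<open>By the hexagons the long composites are braidings with \<open>A \<otimes> A\<close>, so
  the two axioms on \<open>m\<close> are naturality along \<open>m\<close>. The unit axioms are
  naturality along \<open>u\<close> combined with the unit laws of the braiding.\<close>

lemma braided_algebra_braiding: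
  assumes alg: "is_algebra M A m u"
  shows "is_braided_algebra M A m u (\<c> A A)"
proof -
  have A: "A \<in> Obj M" and m: "m \<in> Hom M (A \<otimes> A) A" and u: "u \<in> Hom M \<one> A"
    using alg unfolding is_algebra_def by auto
  have "\<c> A A \<cdot> (u \<otimes>\<^sub>m ID A) \<cdot> \<l>\<^sup>- A = (\<c> A A \<cdot> (u \<otimes>\<^sub>m ID A)) \<cdot> \<l>\<^sup>- A"
    by (rule cmp_assoc[symmetric]) (rule btyping A u)+
  also have "\<dots> = ((ID A \<otimes>\<^sub>m u) \<cdot> \<c> \<one> A) \<cdot> \<l>\<^sup>- A"
    by (simp add: braiding_natural[OF u ident_Hom[OF A]])
  also have "\<dots> = (ID A \<otimes>\<^sub>m u) \<cdot> \<c> \<one> A \<cdot> \<l>\<^sup>- A"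
    by (rule cmp_assoc) (rule btyping A u)+
  finally have l: "\<c> A A \<cdot> (u \<otimes>\<^sub>m ID A) \<cdot> \<l>\<^sup>- A = (ID A \<otimes>\<^sub>m u) \<cdot> \<r>\<^sup>- A"
    by (simp add: braiding_lunit_inv A)
  have "\<c> A A \<cdot> (ID A \<otimes>\<^sub>m u) \<cdot> \<r>\<^sup>- A = (\<c> A A \<cdot> (ID A \<otimes>\<^sub>m u)) \<cdot> \<r>\<^sup>- A"
    by (rule cmp_assoc[symmetric]) (rule btyping A u)+
  also have "\<dots> = ((u \<otimes>\<^sub>m ID A) \<cdot> \<c> A \<one>) \<cdot> \<r>\<^sup>- A"
    by (simp add: braiding_natural[OF ident_Hom[OF A] u])
  also have "\<dots> = (u \<otimes>\<^sub>m ID A) \<cdot> \<c> A \<one> \<cdot> \<r>\<^sup>- A"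
    by (rule cmp_assoc) (rule btyping A u)+
  finally have r: "\<c> A A \<cdot> (ID A \<otimes>\<^sub>m u) \<cdot> \<r>\<^sup>- A = (u \<otimes>\<^sub>m ID A) \<cdot> \<l>\<^sup>- A"
    by (simp add: braiding_runit_inv A)
  show ?thesis
    unfolding is_braided_algebra_def
    using alg l r braided_object_braiding[OF A] braiding_left[OF A A A] braiding_right[OF A A A]
      braiding_natural[OF m ident_Hom[OF A]] braiding_natural[OF ident_Hom[OF A] m]
    by simp
qed

lemma braided_coalgebra_braiding:
  assumes coalg: "is_coalgebra M C \<Delta> \<epsilon>"
  shows "is_braided_coalgebra M C \<Delta> \<epsilon> (\<c> C C)"
proof -
  have C: "C \<in> Obj M" and \<Delta>: "\<Delta> \<in> Hom M C (C \<otimes> C)" and \<epsilon>: "\<epsilon> \<in> Hom M C \<one>"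
    using coalg unfolding is_coalgebra_def by auto
  have "\<l> C \<cdot> (\<epsilon> \<otimes>\<^sub>m ID C) \<cdot> \<c> C C = \<l> C \<cdot> \<c> C \<one> \<cdot> (ID C \<otimes>\<^sub>m \<epsilon>)"
    by (simp add: braiding_natural[OF ident_Hom[OF C] \<epsilon>])
  also have "\<dots> = (\<l> C \<cdot> \<c> C \<one>) \<cdot> (ID C \<otimes>\<^sub>m \<epsilon>)"
    by (rule cmp_assoc[symmetric]) (rule btyping C \<epsilon>)+
  finally have l: "\<l> C \<cdot> (\<epsilon> \<otimes>\<^sub>m ID C) \<cdot> \<c> C C = \<r> C \<cdot> (ID C \<otimes>\<^sub>m \<epsilon>)"
    by (simp add: lunit_braiding C)
  have "\<r> C \<cdot> (ID C \<otimes>\<^sub>m \<epsilon>) \<cdot> \<c> C C = \<r> C \<cdot> \<c> \<one> C \<cdot> (\<epsilon> \<otimes>\<^sub>m ID C)"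
    by (simp add: braiding_natural[OF \<epsilon> ident_Hom[OF C]])
  also have "\<dots> = (\<r> C \<cdot> \<c> \<one> C) \<cdot> (\<epsilon> \<otimes>\<^sub>m ID C)"
    by (rule cmp_assoc[symmetric]) (rule btyping C \<epsilon>)+
  finally have r: "\<r> C \<cdot> (ID C \<otimes>\<^sub>m \<epsilon>) \<cdot> \<c> C C = \<l> C \<cdot> (\<epsilon> \<otimes>\<^sub>m ID C)"
    by (simp add: runit_braiding C)
  have "ID C \<otimes>\<^sub>m \<Delta> \<in> Hom M (C \<otimes> C) (C \<otimes> (C \<otimes> C))" "\<Delta> \<otimes>\<^sub>m ID C \<in> Hom M (C \<otimes> C) (C \<otimes> C \<otimes> C)"
    by (rule btyping C \<Delta>)+
  note cmps = braiding_right_cmp[OF C C C this(1)] braiding_left_cmp[OF C C C this(2)]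
  show ?thesis
    unfolding is_braided_coalgebra_def
    using coalg l r braided_object_braiding[OF C] cmps
      braiding_natural[OF \<Delta> ident_Hom[OF C]] braiding_natural[OF ident_Hom[OF C] \<Delta>]
    by simp
qed

text \<open>The braided axioms hold automatically, and the other four equations say that
  \<open>\<Delta>\<close> and \<open>\<epsilon>\<close> are algebra morphisms. The equivalence, not
  just one direction, is what makes \<open>J_Bialg\<close> reflect objects.\<close>

lemma braided_bialgebra_braiding:
  "is_braided_bialgebra M B m u \<Delta> \<epsilon> (\<c> B B) \<longleftrightarrow> is_bialgebra M B m u \<Delta> \<epsilon>"
proof (cases "is_algebra M B m u \<and> is_coalgebra M B \<Delta> \<epsilon>")
  case True
  then have B: "B \<in> Obj M" and m: "m \<in> Hom M (B \<otimes> B) B" and u: "u \<in> Hom M \<one> B"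
    and \<Delta>: "\<Delta> \<in> Hom M B (B \<otimes> B)" and \<epsilon>: "\<epsilon> \<in> Hom M B \<one>"
    unfolding is_algebra_def is_coalgebra_def by auto
  \<comment> \<open>Only the bracketing separates the two notions: \<open>tensor_alg\<close>
    packages the first two factors as the multiplication of \<open>B \<otimes> B\<close>.\<close>
  have "((m \<otimes>\<^sub>m m) \<cdot> mid_arrow M B (\<c> B B)) \<cdot> (\<Delta> \<otimes>\<^sub>m \<Delta>) = (m \<otimes>\<^sub>m m) \<cdot> mid_arrow M B (\<c> B B) \<cdot> (\<Delta> \<otimes>\<^sub>m \<Delta>)"
    unfolding mid_arrow_def by (rule cmp_assoc) (rule btyping B m \<Delta>)+
  then show ?thesis
    using True \<Delta> \<epsilon> braided_algebra_braiding braided_coalgebra_braiding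
    by (auto simp: is_braided_bialgebra_def is_bialgebra_def alg_morphism_def tensor_alg_def unit_alg_def)
next
  case False
  then show ?thesis
    by (auto simp: is_braided_bialgebra_def is_bialgebra_def is_braided_algebra_def is_braided_coalgebra_def)
qed

end

section \<open>Tensor powers and primitives\<close>

context braided_monoidal_category
begin

section \<open>Braidings between tensor powers\<close>

lemma tpow_Obj: "V \<in> Obj M \<Longrightarrow> tpow M V n \<in> Obj M"
  by (induction n rule: tpow.induct[of _ V]) (auto intro: unit_Obj tensor_Obj)

lemma tpow_iso_Hom:
  assumes V: "V \<in> Obj M"
  shows "tpow_iso M V m n \<in> Hom M (tpow M V m \<otimes> tpow M V n) (tpow M V (m + n))"
  using V
proof (induction V m n rule: tpow_iso.induct)
  case (4 V m n)
  have "\<a>\<^sup>- (tpow M V (Suc m)) (tpow M V (Suc n)) V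
      \<in> Hom M (tpow M V (Suc m) \<otimes> tpow M V (Suc (Suc n))) (tpow M V (Suc m) \<otimes> tpow M V (Suc n) \<otimes> V)"
    using assoc_inv_Hom[OF tpow_Obj[OF 4(2)] tpow_Obj[OF 4(2)] 4(2)] by simp
  moreover have "tpow_iso M V (Suc m) (Suc n) \<otimes>\<^sub>m ID V
      \<in> Hom M (tpow M V (Suc m) \<otimes> tpow M V (Suc n) \<otimes> V) (tpow M V (Suc m + Suc (Suc n)))"
    using tensor_Hom[OF 4(1)[OF 4(2)] ident_Hom[OF 4(2)]] by simp
  ultimately show ?case by (auto intro: cmp_Hom)
qed (auto intro: runit_Hom lunit_Hom ident_Hom tpow_Obj tensor_Obj)

text \<open>The mixed equation is Yang-Baxter for three tensor powers; the additivity clauses are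
  the hexagons followed by naturality along \<open>tpow_iso\<close>.\<close>

lemma is_cT_family_braiding:
  assumes V: "V \<in> Obj M"
  shows "is_cT_family M V (\<c> V V) (\<lambda>m n. \<c> (tpow M V m) (tpow M V n))"
proof -
  note T = tpow_Obj[OF V] and i = tpow_iso_Hom[OF V]
  show ?thesis
    unfolding is_cT_family_def Let_def
    by (intro conjI allI impI braiding_Hom yang_baxter T)
      (simp_all add: T braiding_left braiding_right braiding_lunit_inv braiding_runit_inv
        braiding_natural[OF i ident_Hom] braiding_natural[OF ident_Hom i])
qed

lemma is_cT_familyD:
  assumes "is_cT_family M V c g"
  shows "g a b \<in> Hom M (tpow M V a \<otimes> tpow M V b) (tpow M V b \<otimes> tpow M V a)"
    and "l \<noteq> 0 \<Longrightarrow> m \<noteq> 0 \<Longrightarrow>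
      (ID (tpow M V n) \<otimes>\<^sub>m tpow_iso M V l m) \<cdot> \<a> (tpow M V n) (tpow M V l) (tpow M V m)
        \<cdot> (g l n \<otimes>\<^sub>m ID (tpow M V m)) \<cdot> \<a>\<^sup>- (tpow M V l) (tpow M V n) (tpow M V m)
        \<cdot> (ID (tpow M V l) \<otimes>\<^sub>m g m n) \<cdot> \<a> (tpow M V l) (tpow M V m) (tpow M V n)
      = g (l + m) n \<cdot> (tpow_iso M V l m \<otimes>\<^sub>m ID (tpow M V n))"
    and "m \<noteq> 0 \<Longrightarrow> n \<noteq> 0 \<Longrightarrow>
      (tpow_iso M V m n \<otimes>\<^sub>m ID (tpow M V l)) \<cdot> \<a>\<^sup>- (tpow M V m) (tpow M V n) (tpow M V l)
        \<cdot> (ID (tpow M V m) \<otimes>\<^sub>m g l n) \<cdot> \<a> (tpow M V m) (tpow M V l) (tpow M V n)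
        \<cdot> (g l m \<otimes>\<^sub>m ID (tpow M V n)) \<cdot> \<a>\<^sup>- (tpow M V l) (tpow M V m) (tpow M V n)
      = g l (m + n) \<cdot> (ID (tpow M V l) \<otimes>\<^sub>m tpow_iso M V m n)"
    and "g 0 n \<cdot> \<l>\<^sup>- (tpow M V n) = \<r>\<^sup>- (tpow M V n)"
    and "g n 0 \<cdot> \<r>\<^sup>- (tpow M V n) = \<l>\<^sup>- (tpow M V n)"
    and "g 1 1 = c"
  using assms unfolding is_cT_family_def Let_def by simp_all

text \<open>The unit clauses fix the values with an index 0. The value at \<open>(1, 1)\<close> then
  determines the rest by raising the second index of \<open>g 1 n\<close> and, for fixed second
  index, the first one.\<close>

lemma is_cT_family_unique:
  assumes V: "V \<in> Obj M" and g: "is_cT_family M V c g" and h: "is_cT_family M V c h"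
  shows "g = h"
proof -
  note T = tpow_Obj[OF V]
  have inv: "iso_arrow M X (\<one> \<otimes> X) (\<l>\<^sup>- X)" "iso_arrow M X (X \<otimes> \<one>) (\<r>\<^sup>- X)" if "X \<in> Obj M" for X
    using lunit_inverse[OF that] runit_inverse[OF that] unfolding iso_arrow_def inverse_arrows_def by auto
  have eq_0l: "g 0 n = h 0 n" for n
    by (rule cancel_iso_right[OF inv(1)[OF T[of n]], of _ "tpow M V n \<otimes> \<one>"])
      (use is_cT_familyD(1)[OF g, of 0 n] is_cT_familyD(1)[OF h, of 0 n]
        is_cT_familyD(4)[OF g] is_cT_familyD(4)[OF h] in simp_all)
  have eq_0r: "g n 0 = h n 0" for n
    by (rule cancel_iso_right[OF inv(2)[OF T[of n]], of _ "\<one> \<otimes> tpow M V n"])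
      (use is_cT_familyD(1)[OF g, of n 0] is_cT_familyD(1)[OF h, of n 0]
        is_cT_familyD(5)[OF g] is_cT_familyD(5)[OF h] in simp_all)
  \<comment> \<open>Tensor powers grow on the right, so this identification is an identity and the
    additivity clauses give the next value outright. The \<open>Suc\<close> is needed: those clauses
    exclude index 0, where \<open>tpow_iso\<close> is a unit constraint.\<close>
  have iso1: "tpow_iso M V (Suc k) 1 = ID (tpow M V (Suc k + 1))" for k by simp
  have rec_right: "k 1 (Suc n + 1) =
      (ID (tpow M V (Suc n + 1)) \<otimes>\<^sub>m ID (tpow M V 1)) \<cdot> \<a>\<^sup>- (tpow M V (Suc n)) (tpow M V 1) (tpow M V 1)
        \<cdot> (ID (tpow M V (Suc n)) \<otimes>\<^sub>m k 1 1) \<cdot> \<a> (tpow M V (Suc n)) (tpow M V 1) (tpow M V 1)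
        \<cdot> (k 1 (Suc n) \<otimes>\<^sub>m ID (tpow M V 1)) \<cdot> \<a>\<^sup>- (tpow M V 1) (tpow M V (Suc n)) (tpow M V 1)"
    if k: "is_cT_family M V c k" for k n
    using is_cT_familyD(3)[OF k, of "Suc n" 1 1]
    unfolding iso1 tensor_ident[OF T T] ident_right[OF is_cT_familyD(1)[OF k]] by simp
  have rec_left: "k (Suc m + 1) n =
      (ID (tpow M V n) \<otimes>\<^sub>m ID (tpow M V (Suc m + 1))) \<cdot> \<a> (tpow M V n) (tpow M V (Suc m)) (tpow M V 1)
        \<cdot> (k (Suc m) n \<otimes>\<^sub>m ID (tpow M V 1)) \<cdot> \<a>\<^sup>- (tpow M V (Suc m)) (tpow M V n) (tpow M V 1)
        \<cdot> (ID (tpow M V (Suc m)) \<otimes>\<^sub>m k 1 n) \<cdot> \<a> (tpow M V (Suc m)) (tpow M V 1) (tpow M V n)"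
    if k: "is_cT_family M V c k" for k m n
    using is_cT_familyD(2)[OF k, of "Suc m" 1 n]
    unfolding iso1 tensor_ident[OF T T] ident_right[OF is_cT_familyD(1)[OF k]] by simp
  have eq_1: "g 1 (Suc n) = h 1 (Suc n)" for n
  proof (induction n)
    case 0
    then show ?case using is_cT_familyD(6)[OF g] is_cT_familyD(6)[OF h] by simp
  next
    case (Suc n)
    then show ?case
      using rec_right[OF g, of n] rec_right[OF h, of n] is_cT_familyD(6)[OF g] is_cT_familyD(6)[OF h]
      by simp
  qed
  have eq_1': "g 1 n = h 1 n" for n using eq_1 eq_0r by (cases n) auto
  have "g (Suc m) n = h (Suc m) n" for m n
  proof (induction m)
    case 0
    then show ?case using eq_1' by simp
  next
    case (Suc m)
    then show ?case using rec_left[OF g, of m n] rec_left[OF h, of m n] eq_1' by simp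
  qed
  then have "g m n = h m n" for m n using eq_0l by (cases m) auto
  then show ?thesis by blast
qed

lemma cT_family_braiding:
  assumes V: "V \<in> Obj M"
  shows "cT_family M V (\<c> V V) = (\<lambda>m n. \<c> (tpow M V m) (tpow M V n))"
  unfolding cT_family_def
  using is_cT_family_braiding[OF V] is_cT_family_unique[OF V] by (blast intro: the_equality)

section \<open>Coproduct injections and the braiding of the tensor algebra\<close>

lemma coproduct_joint_epi:
  assumes Q: "is_coproduct M X Q i" and f: "f \<in> Hom M Q Z" and g: "g \<in> Hom M Q Z"
    and eq: "\<And>n. f \<cdot> i n = g \<cdot> i n"
  shows "f = g"
proof -
  have i: "i n \<in> Hom M (X n) Q" for n using Q unfolding is_coproduct_def by blast
  have "\<forall>Z\<in>Obj M. \<forall>f. (\<forall>n. f n \<in> Hom M (X n) Z)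
      \<longrightarrow> (\<exists>!h. h \<in> Hom M Q Z \<and> (\<forall>n. h \<cdot> i n = f n))"
    using Q unfolding is_coproduct_def by simp
  then have "\<exists>!h. h \<in> Hom M Q Z \<and> (\<forall>n. h \<cdot> i n = f \<cdot> i n)"
    using Hom_Obj[OF f] cmp_Hom[OF i f] by simp
  then obtain h where h: "\<And>k. k \<in> Hom M Q Z \<Longrightarrow> \<forall>n. k \<cdot> i n = f \<cdot> i n \<Longrightarrow> k = h"
    by blast
  show ?thesis using h[OF f] h[OF g] eq by simp
qed

text \<open>One factor at a time: \<open>Q \<otimes> Q\<close> is the coproduct of the
  \<open>X m \<otimes> Q\<close>, and each of these is the coproduct of the
  \<open>X m \<otimes> X n\<close>.\<close>

lemma tensor_coproduct_joint_epi:
  assumes pres: "tensor_preserves_denumerable_coproducts M"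
    and Q: "is_coproduct M X Q i" and f: "f \<in> Hom M (Q \<otimes> Q) Z" and g: "g \<in> Hom M (Q \<otimes> Q) Z"
    and eq: "\<And>m n. f \<cdot> (i m \<otimes>\<^sub>m i n) = g \<cdot> (i m \<otimes>\<^sub>m i n)"
  shows "f = g"
proof -
  have i: "i n \<in> Hom M (X n) Q" for n using Q unfolding is_coproduct_def by blast
  have QO: "Q \<in> Obj M" and XO: "X n \<in> Obj M" for n using Hom_Obj[OF i] by auto
  have QQ: "is_coproduct M (\<lambda>n. X n \<otimes> Q) (Q \<otimes> Q) (\<lambda>n. i n \<otimes>\<^sub>m ID Q)"
    using pres Q QO unfolding tensor_preserves_denumerable_coproducts_def by blast
  have XQ: "is_coproduct M (\<lambda>n. X m \<otimes> X n) (X m \<otimes> Q) (\<lambda>n. ID (X m) \<otimes>\<^sub>m i n)" for m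
    using pres Q XO unfolding tensor_preserves_denumerable_coproducts_def by blast
  have iQ: "i m \<otimes>\<^sub>m ID Q \<in> Hom M (X m \<otimes> Q) (Q \<otimes> Q)" for m by (rule typing i QO)+
  have Xi: "ID (X m) \<otimes>\<^sub>m i n \<in> Hom M (X m \<otimes> X n) (X m \<otimes> Q)" for m n by (rule typing i XO)+
  have "f \<cdot> (i m \<otimes>\<^sub>m ID Q) = g \<cdot> (i m \<otimes>\<^sub>m ID Q)" for m
  proof (rule coproduct_joint_epi[OF XQ[of m]])
    show "(f \<cdot> (i m \<otimes>\<^sub>m ID Q)) \<cdot> (ID (X m) \<otimes>\<^sub>m i n) = (g \<cdot> (i m \<otimes>\<^sub>m ID Q)) \<cdot> (ID (X m) \<otimes>\<^sub>m i n)" for n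
      using eq[of m n] tensor_split[OF i i, of m n] cmp_assoc[OF Xi iQ f] cmp_assoc[OF Xi iQ g] by simp
  qed (rule typing iQ f g)+
  then show ?thesis by (rule coproduct_joint_epi[OF QQ f g])
qed

text \<open>Naturality along the injections shows that the braiding of \<open>M\<close> solves the
  defining equations of \<open>tbraid\<close>; the tensored injections are jointly epic, so there is
  no other solution.\<close>

lemma tbraid_braiding:
  assumes pres: "tensor_preserves_denumerable_coproducts M"
    and S: "is_tensor_coproduct_choice M S" and V: "V \<in> Obj M"
  shows "tbraid M S V (\<c> V V) = \<c> (tsum S V) (tsum S V)"
proof -
  have Q: "is_coproduct M (tpow M V) (tsum S V) (\<lambda>n. tinj S n V)"
    using S V unfolding is_tensor_coproduct_choice_def tsum_def tinj_def by simp
  then have i: "tinj S n V \<in> Hom M (tpow M V n) (tsum S V)" and QO: "tsum S V \<in> Obj M" for n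
    unfolding is_coproduct_def by blast+
  have c: "\<c> (tsum S V) (tsum S V) \<in> Hom M (tsum S V \<otimes> tsum S V) (tsum S V \<otimes> tsum S V)"
    by (rule braiding_Hom QO)+
  have eq: "\<c> (tsum S V) (tsum S V) \<cdot> (tinj S m V \<otimes>\<^sub>m tinj S n V)
      = (tinj S n V \<otimes>\<^sub>m tinj S m V) \<cdot> \<c> (tpow M V m) (tpow M V n)" for m n
    by (rule braiding_natural i)+
  show ?thesis
    unfolding tbraid_def cT_family_braiding[OF V]
  proof (rule the_equality)
    fix h
    assume "h \<in> Hom M (tsum S V \<otimes> tsum S V) (tsum S V \<otimes> tsum S V) \<and>
      (\<forall>m n. h \<cdot> (tinj S m V \<otimes>\<^sub>m tinj S n V)
        = (tinj S n V \<otimes>\<^sub>m tinj S m V) \<cdot> \<c> (tpow M V m) (tpow M V n))"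
    then show "h = \<c> (tsum S V) (tsum S V)"
      using eq by (intro tensor_coproduct_joint_epi[OF pres Q _ c]) simp_all
  qed (use c eq in blast)
qed

section \<open>Equalizers and tensor squares of monomorphisms\<close>

lemma equalizer_mono:
  assumes E: "is_equalizer M X Y p q Z e" and f: "f \<in> Hom M W Z" and g: "g \<in> Hom M W Z"
    and eq: "e \<cdot> f = e \<cdot> g"
  shows "f = g"
proof -
  have p: "p \<in> Hom M X Y" and q: "q \<in> Hom M X Y" and e: "e \<in> Hom M Z X" and pq: "p \<cdot> e = q \<cdot> e"
    using E unfolding is_equalizer_def by auto
  have "p \<cdot> e \<cdot> f = q \<cdot> e \<cdot> f"
    using cmp_assoc[OF f e p] cmp_assoc[OF f e q] pq by simp
  then have "\<exists>!k. k \<in> Hom M W Z \<and> e \<cdot> k = e \<cdot> f"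
    using E cmp_Hom[OF f e] unfolding is_equalizer_def by blast
  then obtain h where h: "\<And>k. k \<in> Hom M W Z \<Longrightarrow> e \<cdot> k = e \<cdot> f \<Longrightarrow> k = h"
    by blast
  show ?thesis using h[OF f] h[OF g] eq by simp
qed

text \<open>By \<open>tensor_split\<close>, \<open>e \<otimes>\<^sub>m e\<close> is a composite of
  two arrows that are again equalizers because tensoring preserves them.\<close>

lemma tensor_equalizer_mono:
  assumes pres: "tensor_preserves_equalizers M" and E: "is_equalizer M X Y p q Z e"
    and f: "f \<in> Hom M W (Z \<otimes> Z)" and g: "g \<in> Hom M W (Z \<otimes> Z)"
    and eq: "(e \<otimes>\<^sub>m e) \<cdot> f = (e \<otimes>\<^sub>m e) \<cdot> g"
  shows "f = g"
proof -
  have e: "e \<in> Hom M Z X" using E unfolding is_equalizer_def by auto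
  have Z: "Z \<in> Obj M" and X: "X \<in> Obj M" using Hom_Obj[OF e] by auto
  have E1: "is_equalizer M (Z \<otimes> X) (Z \<otimes> Y) (ID Z \<otimes>\<^sub>m p) (ID Z \<otimes>\<^sub>m q) (Z \<otimes> Z) (ID Z \<otimes>\<^sub>m e)"
    and E2: "is_equalizer M (X \<otimes> X) (Y \<otimes> X) (p \<otimes>\<^sub>m ID X) (q \<otimes>\<^sub>m ID X) (Z \<otimes> X) (e \<otimes>\<^sub>m ID X)"
    using pres E X Z unfolding tensor_preserves_equalizers_def by blast+
  have Ze: "ID Z \<otimes>\<^sub>m e \<in> Hom M (Z \<otimes> Z) (Z \<otimes> X)" and eX: "e \<otimes>\<^sub>m ID X \<in> Hom M (Z \<otimes> X) (X \<otimes> X)"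
    by (rule typing e Z X)+
  show ?thesis
  proof (rule equalizer_mono[OF E1 f g], rule equalizer_mono[OF E2])
    show "(e \<otimes>\<^sub>m ID X) \<cdot> (ID Z \<otimes>\<^sub>m e) \<cdot> f = (e \<otimes>\<^sub>m ID X) \<cdot> (ID Z \<otimes>\<^sub>m e) \<cdot> g"
      using eq cmp_assoc[OF f Ze eX] cmp_assoc[OF g Ze eX] tensor_split[OF e e] by simp
  qed (rule cmp_Hom[OF f Ze] cmp_Hom[OF g Ze])+
qed

text \<open>Fullness is naturality of the braiding: every arrow of \<open>M\<close> is a morphism of
  braided objects between images of \<open>J\<close>.\<close>

lemma full_embedding_J:
  assumes "category (Br M)"
  shows "full_embedding M (Br M) (fob (J M))"
proof -
  have "f \<in> Hom M X Y \<longleftrightarrow> f \<in> Hom (Br M) (X, \<c> X X) (Y, \<c> Y Y)" for f X Y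
    using braided_object_braiding Hom_Obj braiding_natural
    by (auto simp: Br_def br_morphism_def)
  moreover have "X \<in> Obj M \<longleftrightarrow> (X, \<c> X X) \<in> Obj (Br M)" for X
    using braided_object_braiding by (auto simp: Br_def is_braided_object_def)
  ultimately show ?thesis
    using assms by (auto simp: full_embedding_def J_def Br_def)
qed

lemma full_embedding_J_Bialg:
  assumes "category (BrBialg M)"
  shows "full_embedding (Bialg M) (BrBialg M) (fob (J_Bialg M))"
proof -
  have "Hom (Bialg M) X Y = Hom (BrBialg M) (fob (J_Bialg M) X) (fob (J_Bialg M) Y)" for X Y
    using braiding_natural
    by (auto simp: Bialg_def BrBialg_def J_Bialg_def braided_bialgebra_braiding br_morphism_def
        alg_morphism_def split: prod.splits)
  moreover have "X \<in> Obj (Bialg M) \<longleftrightarrow> fob (J_Bialg M) X \<in> Obj (BrBialg M)" for X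
    by (auto simp: Bialg_def BrBialg_def J_Bialg_def braided_bialgebra_braiding split: prod.splits)
  ultimately show ?thesis
    using assms by (auto simp: full_embedding_def J_Bialg_def BrBialg_def Bialg_def split: prod.splits)
qed

text \<open>The braiding of \<open>M\<close> on the primitives satisfies the equation defining
  \<open>prim_braid\<close> by naturality along \<open>\<xi>\<close>, and
  \<open>\<xi> \<otimes>\<^sub>m \<xi>\<close> can be cancelled.\<close>

lemma P_Br_J_Bialg:
  assumes pres: "tensor_preserves_equalizers M" and E: "is_primitives_choice M E"
    and B: "B \<in> Obj (Bialg M)"
  shows "fob (J M) (fob (P_func M E) B) = fob (P_Br M E) (fob (J_Bialg M) B)"
proof -
  obtain A m u \<Delta> \<epsilon> where Beq: "B = (A, m, u, \<Delta>, \<epsilon>)" by (cases B)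
  let ?B = "(A, m, u, \<Delta>, \<epsilon>, \<c> A A)"
  have J: "fob (J_Bialg M) B = ?B" by (simp add: Beq J_Bialg_def)
  have obj: "?B \<in> Obj (BrBialg M)"
    using B by (simp add: Beq Bialg_def BrBialg_def braided_bialgebra_braiding)
  define P \<xi> where "P = prim_obj E ?B" and "\<xi> = xi M E ?B"
  have "is_equalizer M A (A \<otimes> A) \<Delta> (((ID A \<otimes>\<^sub>m u) \<cdot> \<r>\<^sup>- A) \<oplus> ((u \<otimes>\<^sub>m ID A) \<cdot> \<l>\<^sup>- A)) P \<xi>"
    using E obj unfolding is_primitives_choice_def P_def \<xi>_def prim_obj_def xi_def by auto
  note mono = tensor_equalizer_mono[OF pres this] and eq = this
  have \<xi>: "\<xi> \<in> Hom M P A" using eq unfolding is_equalizer_def by auto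
  have c: "\<c> P P \<in> Hom M (P \<otimes> P) (P \<otimes> P)" using Hom_Obj[OF \<xi>] braiding_Hom by blast
  have "prim_braid M E ?B = \<c> P P"
    unfolding prim_braid_def prod.case Let_def P_def[symmetric] \<xi>_def[symmetric]
  proof (rule the_equality)
    fix h
    assume "h \<in> Hom M (P \<otimes> P) (P \<otimes> P) \<and> (\<xi> \<otimes>\<^sub>m \<xi>) \<cdot> h = \<c> A A \<cdot> (\<xi> \<otimes>\<^sub>m \<xi>)"
    then show "h = \<c> P P"
      using braiding_natural[OF \<xi> \<xi>] by (intro mono[OF _ c]) simp_all
  qed (use c braiding_natural[OF \<xi> \<xi>] in simp)
  then show ?thesis
    by (simp add: P_func_def comp_func_def H_Br_def P_Br_def J P_def J_def)
qed

end

section \<open>Restriction of the braided adjunction\<close>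

theorem theorem4p9:
  fixes M :: "('o, 'm) pbm_cat"
    and S :: "'o \<Rightarrow> 'o \<times> (nat \<Rightarrow> 'm)"
    and E :: "'o \<times> 'm \<times> 'm \<times> 'm \<times> 'm \<times> 'm \<Rightarrow> 'o \<times> 'm"
    and etabar_Br :: "'o \<times> 'm \<Rightarrow> 'm"
    and epsbar_Br :: "'o \<times> 'm \<times> 'm \<times> 'm \<times> 'm \<times> 'm \<Rightarrow> 'm"
  assumes "preadditive_braided_monoidal_category M"
    and "has_equalizers M"
    and "tensor_additive M"
    and "tensor_preserves_equalizers M"
    and "has_denumerable_coproducts M"
    and "tensor_preserves_denumerable_coproducts M"
    and "is_tensor_coproduct_choice M S"
    and "is_primitives_choice M E"
    and "adjunction (Br M) (BrBialg M) (Tbar_Br M S) (P_Br M E) etabar_Br epsbar_Br"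
    and "vcomp (Br M) (Br M) (pre_whisker (Br M) (xi M E) (Tbar_Br M S)) etabar_Br = eta_Br M S"
    and "vcomp (BrBialg M) (BrAlg M)
           (pre_whisker (BrBialg M) (epsilon_Br M S) Mho_Br)
           (post_whisker (BrBialg M) (T_Br M S) (P_Br M E) (Omega_Br \<circ>\<^sub>F Mho_Br) (xi M E))
         = post_whisker (BrBialg M) Mho_Br (Tbar_Br M S \<circ>\<^sub>F P_Br M E) Id_func epsbar_Br"
  shows
    "let T = Tbar M S; P = P_func M E;
         nat_eta = nat_transformation M M Id_func (P \<circ>\<^sub>F T);
         nat_eps = nat_transformation (Bialg M) (Bialg M) (T \<circ>\<^sub>F P) Id_func;
         lifts_eta = (\<lambda>\<eta>. pre_whisker M etabar_Br (J M)
           = post_whisker M (J M) Id_func (P \<circ>\<^sub>F T) \<eta>);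
         lifts_eps = (\<lambda>\<epsilon>. pre_whisker (Bialg M) epsbar_Br (J_Bialg M)
           = post_whisker (Bialg M) (J_Bialg M) (T \<circ>\<^sub>F P) Id_func \<epsilon>);
         eq_eta = (\<lambda>\<eta>. vcomp M M (pre_whisker M (xi_Bialg M E) T) \<eta> = eta M S);
         eq_eps = (\<lambda>\<epsilon>. vcomp (Bialg M) (Alg M)
             (pre_whisker (Bialg M) (epsilon M S) Mho)
             (post_whisker (Bialg M) (T_func M S) P (Omega \<circ>\<^sub>F Mho) (xi_Bialg M E))
           = post_whisker (Bialg M) Mho (T \<circ>\<^sub>F P) Id_func \<epsilon>)
     in (\<exists>!\<eta>. nat_eta \<eta> \<and> lifts_eta \<eta>) \<and>
        (\<exists>!\<epsilon>. nat_eps \<epsilon> \<and> lifts_eps \<epsilon>) \<and>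
        (\<forall>\<eta> \<epsilon>. nat_eta \<eta> \<and> lifts_eta \<eta> \<and> nat_eps \<epsilon> \<and> lifts_eps \<epsilon> \<longrightarrow>
           adjunction M (Bialg M) T P \<eta> \<epsilon> \<and>
           (eq_eta \<eta> \<and> (\<forall>\<eta>'. nat_eta \<eta>' \<and> eq_eta \<eta>' \<longrightarrow> \<eta>' = \<eta>)) \<and>
           (eq_eps \<epsilon> \<and> (\<forall>\<epsilon>'. nat_eps \<epsilon>' \<and> eq_eps \<epsilon>' \<longrightarrow> \<epsilon>' = \<epsilon>)))"
proof -
  interpret preadditive_braided_monoidal_category M by (rule assms(1))
  let ?T = "Tbar M S" and ?P = "P_func M E" and ?J = "fob (J M)" and ?K = "fob (J_Bialg M)"
  note adj_Br = assms(9)[unfolded adjunction_def]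
  have cats: "category (Br M)" "category (BrBialg M)"
    using adj_Br unfolding is_functor_def by blast+
  note embJ = full_embedding_J[OF cats(1)] and embK = full_embedding_J_Bialg[OF cats(2)]
  have J_Obj: "?J X \<in> Obj (Br M)" if "X \<in> Obj M" for X
    using embJ that unfolding full_embedding_def by blast
  have K_Obj: "?K Y \<in> Obj (BrBialg M)" if "Y \<in> Obj (Bialg M)" for Y
    using embK that unfolding full_embedding_def by blast
  \<comment> \<open>\<open>Tbar_obj\<close> drops the braiding of the tensor algebra and
    \<open>J_Bialg\<close> puts the one of \<open>M\<close> back, so the equation amounts to
    \<open>tbraid_braiding\<close>.\<close>
  have Tob: "?K (fob ?T X) = fob (Tbar_Br M S) (?J X)" if "X \<in> Obj M" for X
    using tbraid_braiding[OF assms(6,7) that]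
    by (simp add: Tbar_def Tbar_obj_def Tbar_Br_def J_def J_Bialg_def)
  have Tmor: "fmor ?T X Y f = fmor (Tbar_Br M S) (?J X) (?J Y) f" if f: "f \<in> Hom M X Y" for X Y f
  proof -
    have "f \<in> Hom (Br M) (?J X) (?J Y)" using embJ f unfolding full_embedding_def by blast
    then have "fmor (Tbar_Br M S) (?J X) (?J Y) f
        \<in> Hom (BrBialg M) (fob (Tbar_Br M S) (?J X)) (fob (Tbar_Br M S) (?J Y))"
      using adj_Br unfolding is_functor_def by blast
    \<comment> \<open>Fullness of \<open>J_Bialg\<close> supplies the arrow that the definite
      description in \<open>Tbar\<close> asks for; it is unique because \<open>J_Bialg\<close> is
      the identity on arrows.\<close>
    then have "fmor (Tbar_Br M S) (?J X) (?J Y) f \<in> Hom (Bialg M) (fob ?T X) (fob ?T Y)"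
      using Hom_Obj[OF f] by (simp add: full_embedding_Hom[OF embK] Tob)
    then show ?thesis by (auto simp: Tbar_def J_def J_Bialg_def)
  qed
  note Pob = P_Br_J_Bialg[OF assms(4,8)]
  have Pmor: "fmor ?P X Y g = fmor (P_Br M E) (?K X) (?K Y) g" for X Y g
    by (simp add: P_func_def comp_func_def H_Br_def J_Bialg_def)
  define \<eta>0 where "\<eta>0 = (\<lambda>X\<in>Obj M. etabar_Br (?J X))"
  define \<epsilon>0 where "\<epsilon>0 = (\<lambda>Y\<in>Obj (Bialg M). epsbar_Br (?K Y))"
  have adj: "adjunction M (Bialg M) ?T ?P \<eta>0 \<epsilon>0"
    unfolding \<eta>0_def \<epsilon>0_def by (rule adjunction_restrict[OF assms(9) embJ embK Tob Tmor Pob Pmor])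
  have nat: "nat_transformation M M Id_func (?P \<circ>\<^sub>F ?T) \<eta>0"
    "nat_transformation (Bialg M) (Bialg M) (?T \<circ>\<^sub>F ?P) Id_func \<epsilon>0"
    using adj unfolding adjunction_def by blast+
  have T_Obj: "fob ?T X \<in> Obj (Bialg M)" if "X \<in> Obj M" for X
    using adj that unfolding adjunction_def is_functor_def by blast
  \<comment> \<open>Since \<open>J\<close> leaves morphisms alone, the lifting condition prescribes
    every component, and extensionality turns this into an equality of families. This settles
    existence and uniqueness in part 1 at once.\<close>
  have lifts_\<eta>: "pre_whisker M etabar_Br (J M) = post_whisker M (J M) Id_func (?P \<circ>\<^sub>F ?T) \<eta> \<longleftrightarrow> \<eta> = \<eta>0"
    if "nat_transformation M M Id_func (?P \<circ>\<^sub>F ?T) \<eta>" for \<eta>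
    using nat_transformation_extensional[OF that] by (auto simp: pre_whisker_def post_whisker_def \<eta>0_def J_def)
  have lifts_\<epsilon>: "pre_whisker (Bialg M) epsbar_Br (J_Bialg M)
        = post_whisker (Bialg M) (J_Bialg M) (?T \<circ>\<^sub>F ?P) Id_func \<epsilon> \<longleftrightarrow> \<epsilon> = \<epsilon>0"
    if "nat_transformation (Bialg M) (Bialg M) (?T \<circ>\<^sub>F ?P) Id_func \<epsilon>" for \<epsilon>
    using nat_transformation_extensional[OF that] by (auto simp: pre_whisker_def post_whisker_def \<epsilon>0_def J_Bialg_def)
  have eq_\<eta>: "vcomp M M (pre_whisker M (xi_Bialg M E) ?T) \<eta>0 = eta M S"
  proof (rule extensionalityI[of _ "Obj M"])
    fix X
    assume X: "X \<in> Obj M"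
    have "xi_Bialg M E (fob ?T X) = xi M E (fob (Tbar_Br M S) (?J X))"
      using T_Obj[OF X] Tob[OF X] by (simp add: xi_Bialg_def pre_whisker_def)
    moreover have "cmp (Br M) (xi M E (fob (Tbar_Br M S) (?J X))) (etabar_Br (?J X)) = eta_Br M S (?J X)"
      using fun_cong[OF assms(10), of "?J X"] J_Obj[OF X] by (simp add: vcomp_def pre_whisker_def)
    moreover have "eta_Br M S (?J X) = eta M S X"
      using J_Obj[OF X] by (simp add: eta_Br_def J_def)
    ultimately show "vcomp M M (pre_whisker M (xi_Bialg M E) ?T) \<eta>0 X = eta M S X"
      using X by (simp add: vcomp_def pre_whisker_def \<eta>0_def Br_def)
  qed (simp_all add: vcomp_def eta_def)
  \<comment> \<open>Both families have the same composite with \<open>\<xi>\<close> at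
    \<open>fob ?T X\<close>, which is an equalizer and hence a monomorphism.\<close>
  have unique_\<eta>: "\<eta> = \<eta>0"
    if \<eta>: "nat_transformation M M Id_func (?P \<circ>\<^sub>F ?T) \<eta>"
      and eq: "vcomp M M (pre_whisker M (xi_Bialg M E) ?T) \<eta> = eta M S" for \<eta>
  proof (rule extensionalityI[of _ "Obj M"])
    fix X
    assume X: "X \<in> Obj M"
    let ?B = "?K (fob ?T X)"
    obtain A m u \<Delta> \<epsilon> c where B: "?B = (A, m, u, \<Delta>, \<epsilon>, c)" by (cases ?B)
    have "is_equalizer M A (A \<otimes>\<^bsub>M\<^esub> A) \<Delta>
        (((ID\<^bsub>M\<^esub> A \<otimes>\<^sub>m\<^bsub>M\<^esub> u) \<cdot>\<^bsub>M\<^esub> \<r>\<^sup>-\<^bsub>M\<^esub> A) \<oplus>\<^bsub>M\<^esub> ((u \<otimes>\<^sub>m\<^bsub>M\<^esub> ID\<^bsub>M\<^esub> A) \<cdot>\<^bsub>M\<^esub> \<l>\<^sup>-\<^bsub>M\<^esub> A)) (fst (E ?B)) (snd (E ?B))"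
      using assms(8) K_Obj[OF T_Obj[OF X]] B unfolding is_primitives_choice_def by auto
    moreover have "fob (?P \<circ>\<^sub>F ?T) X = fst (E ?B)"
      by (simp add: comp_func_def P_func_def H_Br_def P_Br_def prim_obj_def)
    moreover have "snd (E ?B) = xi_Bialg M E (fob ?T X)"
      using T_Obj[OF X] K_Obj[OF T_Obj[OF X]] by (simp add: xi_Bialg_def pre_whisker_def xi_def)
    moreover have "xi_Bialg M E (fob ?T X) \<cdot>\<^bsub>M\<^esub> \<eta> X = xi_Bialg M E (fob ?T X) \<cdot>\<^bsub>M\<^esub> \<eta>0 X"
      using fun_cong[OF eq, of X] fun_cong[OF eq_\<eta>, of X] X by (simp add: vcomp_def pre_whisker_def)
    ultimately show "\<eta> X = \<eta>0 X"
      using \<eta> nat(1) X unfolding nat_transformation_def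
      by (intro equalizer_mono[of A "A \<otimes>\<^bsub>M\<^esub> A" \<Delta> _ "fst (E ?B)" "snd (E ?B)" "\<eta> X" X "\<eta>0 X"])
        (auto simp: PiE_iff Id_func_def)
  qed (use \<eta> nat(1) in \<open>auto simp: nat_transformation_def PiE_iff\<close>)
  \<comment> \<open>The composite equals \<open>\<epsilon>0\<close> itself, as whiskering with
    \<open>Mho\<close> changes nothing. Uniqueness of the counit is then immediate, without any
    cancellation.\<close>
  have eq_\<epsilon>: "vcomp (Bialg M) (Alg M) (pre_whisker (Bialg M) (epsilon M S) Mho)
        (post_whisker (Bialg M) (T_func M S) ?P (Omega \<circ>\<^sub>F Mho) (xi_Bialg M E)) = \<epsilon>0"
  proof (rule extensionalityI[of _ "Obj (Bialg M)"])
    fix Y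
    assume Y: "Y \<in> Obj (Bialg M)"
    obtain A m u \<Delta> \<epsilon> where B: "Y = (A, m, u, \<Delta>, \<epsilon>)" by (cases Y)
    \<comment> \<open>Outside of the braided algebras \<open>epsilon_Br\<close> is
      \<open>undefined\<close>; this membership lets it be replaced by \<open>epsilon\<close> at
      \<open>(A, m, u)\<close>.\<close>
    have "is_braided_algebra M A m u (\<c>\<^bsub>M\<^esub> A A)"
      using K_Obj[OF Y] by (simp add: B J_Bialg_def BrBialg_def is_braided_bialgebra_def)
    then show "vcomp (Bialg M) (Alg M) (pre_whisker (Bialg M) (epsilon M S) Mho)
        (post_whisker (Bialg M) (T_func M S) ?P (Omega \<circ>\<^sub>F Mho) (xi_Bialg M E)) Y = \<epsilon>0 Y"
      using fun_cong[OF assms(11), of "?K Y"] K_Obj[OF Y] Y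
      by (simp add: vcomp_def pre_whisker_def post_whisker_def \<epsilon>0_def xi_Bialg_def B J_Bialg_def
          Mho_def Mho_Br_def Omega_def Omega_Br_def comp_func_def P_func_def H_Br_def P_Br_def
          T_func_def T_Br_def Alg_def BrAlg_def epsilon_Br_def)
  qed (simp_all add: vcomp_def \<epsilon>0_def)
  have Mho_\<epsilon>: "post_whisker (Bialg M) Mho (?T \<circ>\<^sub>F ?P) Id_func \<epsilon> = \<epsilon>"
    if "nat_transformation (Bialg M) (Bialg M) (?T \<circ>\<^sub>F ?P) Id_func \<epsilon>" for \<epsilon>
    using nat_transformation_extensional[OF that] by (simp add: post_whisker_def Mho_def)
  show ?thesis
    unfolding Let_def
  proof (intro conjI allI impI; (elim conjE)?)
    show "\<exists>!\<eta>. nat_transformation M M Id_func (?P \<circ>\<^sub>F ?T) \<eta> \<and>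
        pre_whisker M etabar_Br (J M) = post_whisker M (J M) Id_func (?P \<circ>\<^sub>F ?T) \<eta>"
      using nat(1) lifts_\<eta> by (intro ex1I[of _ \<eta>0]) blast+
    show "\<exists>!\<epsilon>. nat_transformation (Bialg M) (Bialg M) (?T \<circ>\<^sub>F ?P) Id_func \<epsilon> \<and>
        pre_whisker (Bialg M) epsbar_Br (J_Bialg M)
          = post_whisker (Bialg M) (J_Bialg M) (?T \<circ>\<^sub>F ?P) Id_func \<epsilon>"
      using nat(2) lifts_\<epsilon> by (intro ex1I[of _ \<epsilon>0]) blast+
  next
    fix \<eta> \<epsilon>
    assume \<eta>: "nat_transformation M M Id_func (?P \<circ>\<^sub>F ?T) \<eta>"
        "pre_whisker M etabar_Br (J M) = post_whisker M (J M) Id_func (?P \<circ>\<^sub>F ?T) \<eta>"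
      and \<epsilon>: "nat_transformation (Bialg M) (Bialg M) (?T \<circ>\<^sub>F ?P) Id_func \<epsilon>"
        "pre_whisker (Bialg M) epsbar_Br (J_Bialg M)
          = post_whisker (Bialg M) (J_Bialg M) (?T \<circ>\<^sub>F ?P) Id_func \<epsilon>"
    have \<eta>0: "\<eta> = \<eta>0" using lifts_\<eta> \<eta> by blast
    have \<epsilon>0: "\<epsilon> = \<epsilon>0" using lifts_\<epsilon> \<epsilon> by blast
    show "adjunction M (Bialg M) ?T ?P \<eta> \<epsilon>" unfolding \<eta>0 \<epsilon>0 by (rule adj)
    show "vcomp M M (pre_whisker M (xi_Bialg M E) ?T) \<eta> = eta M S" unfolding \<eta>0 by (rule eq_\<eta>)
    show "\<eta>' = \<eta>" if "nat_transformation M M Id_func (?P \<circ>\<^sub>F ?T) \<eta>'"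
      "vcomp M M (pre_whisker M (xi_Bialg M E) ?T) \<eta>' = eta M S" for \<eta>'
      unfolding \<eta>0 using that by (rule unique_\<eta>)
    show "vcomp (Bialg M) (Alg M) (pre_whisker (Bialg M) (epsilon M S) Mho)
        (post_whisker (Bialg M) (T_func M S) ?P (Omega \<circ>\<^sub>F Mho) (xi_Bialg M E))
      = post_whisker (Bialg M) Mho (?T \<circ>\<^sub>F ?P) Id_func \<epsilon>"
      using eq_\<epsilon> Mho_\<epsilon>[OF \<epsilon>(1)] \<epsilon>0 by metis
    show "\<epsilon>' = \<epsilon>" if "nat_transformation (Bialg M) (Bialg M) (?T \<circ>\<^sub>F ?P) Id_func \<epsilon>'"
      "vcomp (Bialg M) (Alg M) (pre_whisker (Bialg M) (epsilon M S) Mho)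
        (post_whisker (Bialg M) (T_func M S) ?P (Omega \<circ>\<^sub>F Mho) (xi_Bialg M E))
      = post_whisker (Bialg M) Mho (?T \<circ>\<^sub>F ?P) Id_func \<epsilon>'" for \<epsilon>'
      using that(2) eq_\<epsilon> Mho_\<epsilon>[OF that(1)] \<epsilon>0 by metis
  qed
qed

end
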